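(* Let $\beta,L>0$ and let $\theta_0\in(-\pi,\pi)^d$. For each $f\in\mathcal{P}_D(\beta,L)$ let $\mathbb{P}=\mathbb{P}_f$ denote the law under which $\{X(t),t\in\mathbb{Z}^d\}$ is a zero-mean real stationary Gaussian process in $\mathbb{H}$ with spectral density $f$. Let $\mathcal{M}_n$ be the class of all possible estimators $f_n$ of $f$ based on the observations $X(t)$, $t\in\{1,\dots,n\}^d$. Then $$\liminf_{n\to\infty}\ \inf_{f_n\in\mathcal{M}_n}\ \sup_{f\in\mathcal{P}_D(\beta,L)}\mathbb{P}\Big(\|f_n(\theta_0)-f(\theta_0)\|_{\rm HS}\ge n^{-\frac{d\beta}{2\beta+d}}\Big)>0.$$
   Context: $\mathbb{H}\neq\{0\}$ is a separable complex Hilbert space with a fixed complete orthonormal system $\{e_j\}$ (the "real" CONS); $x\in\mathbb{H}$ is real if all $\langle x,e_j\rangle$ are real; a process is real if all its values are real. $x\otimes y$ is the operator $z\mapsto x\langle z,y\rangle$; $\|\cdot\|_{\rm tr}$, $\|\cdot\|_{\rm HS}$ are the trace and Hilbert–Schmidt norms. For a real zero-mean stationary process indexed by $\mathbb{Z}^d$, $C(k)=\mathbb{E}[X(t+k)\otimes X(t)]$, and its spectral density (when $\sum_k\|C(k)\|_{\rm tr}<\infty$) is $f(\theta)=(2\pi)^{-d}\sum_{k\in\mathbb{Z}^d}e^{\mathrm{i}k^\top\theta}C(k)$, $\theta\in[-\pi,\pi]^d$. $\mathcal{P}_D(\beta,L)$ is the class of spectral densities of such processes with $\sum_{k\in\mathbb{Z}^d}\|C(k)\|_{\rm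 tr}(1+\|k\|_2^\beta)\le L$. An estimator $f_n(\theta_0)$ is any measurable function of the observations with values in the Hilbert–Schmidt operators on $\mathbb{H}$. *)

theory Defs
  imports "HOL-Probability.Probability"
begin

text \<open>
  Complex Hilbert spaces are Banach spaces whose norm comes from a complex inner product, linear
  in its \<^emph>\<open>first\<close> argument. Separability is the additional sort constraint
  \<^class>\<open>second_countable_topology\<close>.
\<close>

class complex_hilbert = banach +
  fixes scaleC :: "complex \<Rightarrow> 'a \<Rightarrow> 'a"  (infixr \<open>*\<^sub>C\<close> 75)
    and cinner :: "'a \<Rightarrow> 'a \<Rightarrow> complex"
  assumes scaleC_add_right: "a *\<^sub>C (x + y) = a *\<^sub>C x + a *\<^sub>C y"
    and scaleC_add_left: "(a + b) *\<^sub>C x = a *\<^sub>C x + b *\<^sub>C x"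
    and scaleC_scaleC: "a *\<^sub>C (b *\<^sub>C x) = (a * b) *\<^sub>C x"
    and scaleR_scaleC: "r *\<^sub>R x = complex_of_real r *\<^sub>C x"
    and cinner_add_left: "cinner (x + y) z = cinner x z + cinner y z"
    and cinner_scaleC_left: "cinner (a *\<^sub>C x) y = a * cinner x y"
    and cinner_commute: "cinner x y = cnj (cinner y x)"
    and cinner_self: "cinner x x = complex_of_real ((norm x)\<^sup>2)"

instantiation complex :: complex_hilbert
begin
definition scaleC_complex_def: "a *\<^sub>C (x::complex) = a * x"
definition cinner_complex_def: "cinner x (y::complex) = x * cnj y"
instance
  by standard
    (auto simp: scaleC_complex_def cinner_complex_def algebra_simps scaleR_conv_of_real
      complex_norm_square simp flip: of_real_power)
end

definition complete_orthonormal_system :: "'h::complex_hilbert set \<Rightarrow> bool" where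
  "complete_orthonormal_system E \<longleftrightarrow>
     (\<forall>x\<in>E. \<forall>y\<in>E. cinner x y = (if x = y then 1 else 0)) \<and>
     closure {\<Sum>e\<in>F. c e *\<^sub>C e | F c. finite F \<and> F \<subseteq> E} = UNIV"

definition real_vec :: "'h::complex_hilbert set \<Rightarrow> 'h \<Rightarrow> bool" where
  "real_vec E x \<longleftrightarrow> (\<forall>e\<in>E. cinner x e \<in> \<real>)"

definition bounded_clinear :: "('h::complex_hilbert \<Rightarrow> 'h) \<Rightarrow> bool" where
  "bounded_clinear A \<longleftrightarrow> bounded_linear A \<and> (\<forall>c x. A (c *\<^sub>C x) = c *\<^sub>C A x)"

definition tensor :: "'h::complex_hilbert \<Rightarrow> 'h \<Rightarrow> 'h \<Rightarrow> 'h"  (infixr \<open>\<otimes>\<^sub>H\<close> 70) where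
  "x \<otimes>\<^sub>H y = (\<lambda>z. cinner z y *\<^sub>C x)"

definition cadjoint :: "('h::complex_hilbert \<Rightarrow> 'h) \<Rightarrow> 'h \<Rightarrow> 'h" where
  "cadjoint A = (SOME A'. \<forall>x y. cinner (A x) y = cinner x (A' y))"

definition positive_op :: "('h::complex_hilbert \<Rightarrow> 'h) \<Rightarrow> bool" where
  "positive_op B \<longleftrightarrow> bounded_clinear B \<and> (\<forall>x. cinner (B x) x \<in> \<real> \<and> Re (cinner (B x) x) \<ge> 0)"

text \<open>The modulus \<open>(A\<^sup>* A)\<^bsup>1/2\<^esup>\<close>.\<close>

definition op_abs :: "('h::complex_hilbert \<Rightarrow> 'h) \<Rightarrow> 'h \<Rightarrow> 'h" where
  "op_abs A = (THE B. positive_op B \<and> B \<circ> B = cadjoint A \<circ> A)"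

text \<open>
  The trace and Hilbert--Schmidt norms are computed in the given complete orthonormal system; their
  values do not depend on it. The trace norm takes values in \<open>[0,\<infinity>]\<close>, whereas the
  Hilbert--Schmidt norm is only meaningful on \<open>hs_operators\<close>.
\<close>

definition trace_norm :: "'h::complex_hilbert set \<Rightarrow> ('h \<Rightarrow> 'h) \<Rightarrow> ennreal" where
  "trace_norm E A = (\<Sum>\<^sub>\<infinity>e\<in>E. ennreal (Re (cinner (op_abs A e) e)))"

definition hs_operators :: "'h::complex_hilbert set \<Rightarrow> ('h \<Rightarrow> 'h) set" where
  "hs_operators E = {A. bounded_clinear A \<and> (\<lambda>e. (norm (A e))\<^sup>2) summable_on E}"

definition hs_norm :: "'h::complex_hilbert set \<Rightarrow> ('h \<Rightarrow> 'h) \<Rightarrow> real" where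
  "hs_norm E A = sqrt (\<Sum>\<^sub>\<infinity>e\<in>E. (norm (A e))\<^sup>2)"

definition hs_dist :: "'h::complex_hilbert set \<Rightarrow> ('h \<Rightarrow> 'h) \<Rightarrow> ('h \<Rightarrow> 'h) \<Rightarrow> real" where
  "hs_dist E A B = hs_norm E (\<lambda>x. A x - B x)"

lemma hs_finite_bound:
  assumes "A \<in> hs_operators E" "finite F" "F \<subseteq> E"
  shows "L2_set (\<lambda>e. norm (A e)) F \<le> hs_norm E A"
  using assms
  by (auto simp: hs_operators_def hs_norm_def L2_set_def intro!: finite_sum_le_infsum)

lemma hs_diff_bound:
  assumes A: "A \<in> hs_operators E" and B: "B \<in> hs_operators E" and F: "finite F" "F \<subseteq> E"
  shows "(\<Sum>e\<in>F. (norm (A e - B e))\<^sup>2) \<le> (hs_norm E A + hs_norm E B)\<^sup>2"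
proof -
  have "L2_set (\<lambda>e. norm (A e - B e)) F \<le> L2_set (\<lambda>e. norm (A e) + norm (B e)) F"
    by (intro L2_set_mono norm_triangle_ineq4) auto
  also have "\<dots> \<le> L2_set (\<lambda>e. norm (A e)) F + L2_set (\<lambda>e. norm (B e)) F"
    by (rule L2_set_triangle_ineq)
  also have "\<dots> \<le> hs_norm E A + hs_norm E B"
    by (intro add_mono hs_finite_bound A B F)
  finally have "(L2_set (\<lambda>e. norm (A e - B e)) F)\<^sup>2 \<le> (hs_norm E A + hs_norm E B)\<^sup>2"
    by (intro power_mono) auto
  thus ?thesis by (simp add: L2_set_def sum_nonneg)
qed

lemma hs_operators_diff:
  assumes A: "A \<in> hs_operators E" and B: "B \<in> hs_operators E"
  shows "(\<lambda>x. A x - B x) \<in> hs_operators E"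
proof -
  have "scaleC c (x - y) = scaleC c x - scaleC c y" for c and x y :: 'a
    by (metis add_diff_cancel_right' diff_add_cancel scaleC_add_right)
  hence "bounded_clinear (\<lambda>x. A x - B x)"
    using A B by (auto simp: hs_operators_def bounded_clinear_def intro: bounded_linear_sub)
  moreover have "(\<lambda>e. (norm (A e - B e))\<^sup>2) summable_on E"
    by (rule nonneg_bdd_above_summable_on)
      (auto intro!: bdd_aboveI[of _ "(hs_norm E A + hs_norm E B)\<^sup>2"] hs_diff_bound A B)
  ultimately show ?thesis by (simp add: hs_operators_def)
qed

lemma hs_norm_diff_le:
  assumes A: "A \<in> hs_operators E" and B: "B \<in> hs_operators E"
  shows "hs_norm E (\<lambda>x. A x - B x) \<le> hs_norm E A + hs_norm E B"
proof -
  have "(\<Sum>\<^sub>\<infinity>e\<in>E. (norm (A e - B e))\<^sup>2) \<le> (hs_norm E A + hs_norm E B)\<^sup>2"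
    using hs_operators_diff[OF A B] hs_diff_bound[OF A B]
    by (intro infsum_le_finite_sums) (auto simp: hs_operators_def)
  moreover have "hs_norm E A \<ge> 0" "hs_norm E B \<ge> 0"
    by (auto simp: hs_norm_def infsum_nonneg)
  ultimately show ?thesis
    unfolding hs_norm_def[of E "\<lambda>x. A x - B x"] by (intro real_le_lsqrt) auto
qed

lemma Metric_space_hs:
  assumes "complete_orthonormal_system E"
  shows "Metric_space (hs_operators E) (hs_dist E)"
proof
  fix A B C :: "'a \<Rightarrow> 'a"
  show "0 \<le> hs_dist E A B" by (simp add: hs_dist_def hs_norm_def infsum_nonneg)
  show "hs_dist E A B = hs_dist E B A" by (simp add: hs_dist_def hs_norm_def norm_minus_commute)
  assume A: "A \<in> hs_operators E" and B: "B \<in> hs_operators E"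
  let ?D = "\<lambda>x. A x - B x"
  have D: "?D \<in> hs_operators E" by (rule hs_operators_diff[OF A B])
  show "hs_dist E A B = 0 \<longleftrightarrow> A = B"
  proof
    assume "hs_dist E A B = 0"
    hence z: "?D e = 0" if "e \<in> E" for e
      using that hs_finite_bound[OF D, of "{e}"] by (auto simp: hs_dist_def)
    have lin: "bounded_linear ?D" and clin: "?D (scaleC c x) = scaleC c (?D x)" for c x
      using D by (auto simp: hs_operators_def bounded_clinear_def)
    have sc0: "scaleC c (0::'a) = 0" for c
      using scaleC_add_right[of c "0::'a" 0] by simp
    have "{\<Sum>e\<in>F. scaleC (c e) e | F c. finite F \<and> F \<subseteq> E} \<subseteq> {x. ?D x = 0}"
    proof clarify
      fix F c assume F: "finite F" "F \<subseteq> E"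
      have "?D (\<Sum>e\<in>F. scaleC (c e) e) = (\<Sum>e\<in>F. ?D (scaleC (c e) e))"
        using linear_sum[OF bounded_linear.linear[OF lin]] by blast
      also have "\<dots> = 0" using z F by (intro sum.neutral) (auto simp: clin sc0 simp del: right_minus_eq)
      finally show "?D (\<Sum>e\<in>F. scaleC (c e) e) = 0" .
    qed
    moreover have "closed {x. ?D x = 0}"
      using lin by (intro closed_Collect_eq linear_continuous_on continuous_on_const)
    ultimately have "closure {\<Sum>e\<in>F. scaleC (c e) e | F c. finite F \<and> F \<subseteq> E} \<subseteq> {x. ?D x = 0}"
      by (rule closure_minimal)
    thus "A = B" using assms by (auto simp: complete_orthonormal_system_def)
  qed (simp add: hs_dist_def hs_norm_def)
  assume C: "C \<in> hs_operators E"
  have "hs_dist E A C = hs_norm E (\<lambda>x. (A x - B x) - (C x - B x))"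
    by (simp add: hs_dist_def)
  also have "\<dots> \<le> hs_dist E A B + hs_dist E C B"
    unfolding hs_dist_def by (intro hs_norm_diff_le hs_operators_diff A B C)
  also have "hs_dist E C B = hs_dist E B C"
    by (simp add: hs_dist_def hs_norm_def norm_minus_commute)
  finally show "hs_dist E A C \<le> hs_dist E A B + hs_dist E B C" .
qed

definition hs_borel :: "'h::complex_hilbert set \<Rightarrow> ('h \<Rightarrow> 'h) measure" where
  "hs_borel E = sigma (hs_operators E)
     {U. openin (Metric_space.mtopology (hs_operators E) (hs_dist E)) U}"

text \<open>
  The expectation of \<open>X \<otimes>\<^sub>H Y\<close>, given by its action on vectors (a Bochner integral in \<open>'h\<close>).
\<close>

definition cross_cov ::
  "'w measure \<Rightarrow> ('w \<Rightarrow> 'h::{complex_hilbert, second_countable_topology}) \<Rightarrow> ('w \<Rightarrow> 'h) \<Rightarrow> 'h \<Rightarrow> 'h"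
where
  "cross_cov M X Y = (\<lambda>z. \<integral>\<omega>. (X \<omega> \<otimes>\<^sub>H Y \<omega>) z \<partial>M)"

text \<open>
  A real zero-mean second-order stationary process. Values are required to be real almost surely,
  since the condition is later imposed on coordinate processes on the full path space.
\<close>

definition real_stationary_process ::
  "'h::{complex_hilbert, second_countable_topology} set \<Rightarrow> 'w measure \<Rightarrow> (int ^ 'd \<Rightarrow> 'w \<Rightarrow> 'h) \<Rightarrow> bool"
where
  "real_stationary_process E M X \<longleftrightarrow>
     prob_space M \<and>
     (\<forall>t. X t \<in> borel_measurable M) \<and>
     (\<forall>t. integrable M (\<lambda>\<omega>. (norm (X t \<omega>))\<^sup>2)) \<and>
     (\<forall>t. AE \<omega> in M. real_vec E (X t \<omega>)) \<and>
     (\<forall>t. (\<integral>\<omega>. X t \<omega> \<partial>M) = 0) \<and>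
     (\<forall>s t k. cross_cov M (X (t + k)) (X t) = cross_cov M (X (s + k)) (X s))"

definition autocov ::
  "'w measure \<Rightarrow> (int ^ 'd \<Rightarrow> 'w \<Rightarrow> 'h::{complex_hilbert, second_countable_topology})
     \<Rightarrow> int ^ 'd \<Rightarrow> 'h \<Rightarrow> 'h"
where
  "autocov M X k = cross_cov M (X (0 + k)) (X 0)"

definition real_of_int_vec :: "int ^ 'd \<Rightarrow> real ^ 'd" where
  "real_of_int_vec k = (\<chi> i. real_of_int (k $ i))"

definition freq_cube :: "(real ^ 'd) set" where
  "freq_cube = {\<theta>. \<forall>i. - pi \<le> \<theta> $ i \<and> \<theta> $ i \<le> pi}"

text \<open>
  Spectral densities are functions on the frequency cube, hence extensional. The operator series is
  summed pointwise; under the summability condition it converges absolutely in trace norm to the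
  same operator.
\<close>

definition has_spectral_density ::
  "'h::{complex_hilbert, second_countable_topology} set \<Rightarrow> 'w measure \<Rightarrow> (int ^ 'd \<Rightarrow> 'w \<Rightarrow> 'h)
     \<Rightarrow> (real ^ 'd \<Rightarrow> 'h \<Rightarrow> 'h) \<Rightarrow> bool"
where
  "has_spectral_density E M X f \<longleftrightarrow>
     (\<Sum>\<^sub>\<infinity>k. trace_norm E (autocov M X k)) < \<infinity> \<and>
     f = (\<lambda>\<theta>\<in>freq_cube. \<lambda>z. (1 / (2 * pi) ^ CARD('d)) *\<^sub>R
            (\<Sum>\<^sub>\<infinity>k. exp (\<i> * complex_of_real (real_of_int_vec k \<bullet> \<theta>)) *\<^sub>C autocov M X k z))"

definition real_normal_law :: "real measure \<Rightarrow> bool" where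
  "real_normal_law N \<longleftrightarrow>
     (\<exists>\<mu>. N = return borel \<mu>) \<or>
     (\<exists>\<mu> \<sigma>. \<sigma> > 0 \<and> N = density lborel (\<lambda>x. ennreal (normal_density \<mu> \<sigma> x)))"

text \<open>
  All finite-dimensional distributions are Gaussian, i.e. all their images under continuous
  real-linear functionals are (possibly degenerate) normal laws.
\<close>

definition gaussian_process ::
  "'w measure \<Rightarrow> (int ^ 'd \<Rightarrow> 'w \<Rightarrow> 'h::{complex_hilbert, second_countable_topology}) \<Rightarrow> bool"
where
  "gaussian_process M X \<longleftrightarrow>
     (\<forall>T h. finite T \<longrightarrow> real_normal_law (distr M borel (\<lambda>\<omega>. \<Sum>t\<in>T. Re (cinner (X t \<omega>) (h t)))))"

text \<open>
  Processes enter only through their laws, so they are taken to be coordinate processes under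
  probability measures on the path space; every process on any probability space induces one.
\<close>

definition path_space :: "(int ^ 'd \<Rightarrow> 'h::topological_space) measure" where
  "path_space = (\<Pi>\<^sub>M t\<in>UNIV. borel)"

definition coord :: "int ^ 'd \<Rightarrow> (int ^ 'd \<Rightarrow> 'h) \<Rightarrow> 'h" where
  "coord t \<omega> = \<omega> t"

definition density_class ::
  "'h::{complex_hilbert, second_countable_topology} set \<Rightarrow> real \<Rightarrow> real \<Rightarrow> (real ^ 'd \<Rightarrow> 'h \<Rightarrow> 'h) set"
where
  "density_class E \<beta> L =
     {f. \<exists>P. sets P = sets path_space \<and> real_stationary_process E P coord \<and>
           has_spectral_density E P coord f \<and>
           (\<Sum>\<^sub>\<infinity>k. trace_norm E (autocov P coord k) *
                   ennreal (1 + norm (real_of_int_vec k) powr \<beta>)) \<le> ennreal L}"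

text \<open>
  The laws under which the coordinates form a zero-mean real stationary Gaussian process with
  spectral density \<open>f\<close>. There is only one: \<open>f\<close> determines the autocovariances by Fourier
  inversion, and these determine the finite-dimensional distributions.
\<close>

definition gaussian_laws ::
  "'h::{complex_hilbert, second_countable_topology} set \<Rightarrow> (real ^ 'd \<Rightarrow> 'h \<Rightarrow> 'h)
     \<Rightarrow> (int ^ 'd \<Rightarrow> 'h) measure set"
where
  "gaussian_laws E f =
     {P. sets P = sets path_space \<and> real_stationary_process E P coord \<and> gaussian_process P coord \<and>
         has_spectral_density E P coord f}"

definition obs_cube :: "nat \<Rightarrow> (int ^ 'd) set" where
  "obs_cube n = {t. \<forall>i. 1 \<le> t $ i \<and> t $ i \<le> int n}"

definition estimators ::
  "'h::{complex_hilbert, second_countable_topology} set \<Rightarrow> nat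
     \<Rightarrow> (real ^ 'd \<Rightarrow> (int ^ 'd \<Rightarrow> 'h) \<Rightarrow> 'h \<Rightarrow> 'h) set"
where
  "estimators E n =
     {fn. \<forall>\<theta>\<in>freq_cube. fn \<theta> \<in> (\<Pi>\<^sub>M t\<in>obs_cube n. borel) \<rightarrow>\<^sub>M hs_borel E}"

end

theory Submission
  imports Defs
begin

text \<open>
  Fix a unit vector \<open>e\<close> of the real system and consider processes with values in its span. Under the
  null hypothesis the coefficients are white noise \<open>\<tau> Z\<close>. The alternative adds \<open>J\<close> independent
  layers \<open>\<tau> b (U t cos (t \<bullet> \<theta>) + V t sin (t \<bullet> \<theta>))\<close>, where \<open>U\<close> and \<open>V\<close> are independent moving
  averages of white noise over a cube of side \<open>m\<close>. Each layer adds \<open>\<tau>\<^sup>2 b\<^sup>2 F k cos (k \<bullet> \<theta>)\<close> to the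
  autocovariance, where \<open>F k\<close> counts the pairs of points of the cube with difference \<open>k\<close>, and hence
  at least a multiple of \<open>\<tau>\<^sup>2 b\<^sup>2 m ^ (2 d)\<close> to the spectral density at \<open>\<theta>\<close>. The constraint of the
  class permits \<open>J b\<^sup>2 m ^ (2 d)\<close> of order \<open>m powr (- \<beta>)\<close>, and \<open>m\<close> is taken of order
  \<open>n powr (d / (2 * \<beta> + d))\<close>.

  A single layer is Gaussian noise independent of everything else, so conditionally on it the white
  noise is merely shifted. The second moment of the likelihood ratio is the exponential moment of
  the inner product of two independent layers, which is at most \<open>2\<close> as soon as the squared
  Hilbert--Schmidt norm of the covariance of the layer on the observed cube, in units of \<open>\<tau>\<^sup>2\<close>,
  is at most \<open>1 / 2\<close>. By the Cauchy--Schwarz inequality adding one layer turns the probability \<open>p\<close> of any event into at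
  most \<open>sqrt (2 * p)\<close>. Since the class radius may be small, one layer need not separate the two
  densities by twice the rate, but a fixed number \<open>J\<close> of layers does, and iterating the bound \<open>J\<close>
  times still forces an estimator that succeeds with high probability under the null hypothesis to
  fail under the alternative.
\<close>

section \<open>Gaussian mixtures of shifts\<close>

definition std_normal :: "real measure" where
  "std_normal = density lborel std_normal_density"

lemma sets_std_normal [simp, measurable_cong]: "sets std_normal = sets borel"
  and space_std_normal [simp]: "space std_normal = UNIV"
  by (simp_all add: std_normal_def)

lemma prob_space_std_normal: "prob_space std_normal"
  unfolding std_normal_def by (rule prob_space_normal_density) simp

interpretation gauss: product_prob_space "\<lambda>_. std_normal" I for I
  by (intro product_prob_spaceI prob_space_std_normal)

abbreviation gauss :: "'i set \<Rightarrow> ('i \<Rightarrow> real) measure" where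
  "gauss I \<equiv> PiM I (\<lambda>_. std_normal)"

text \<open>Translation invariance of Lebesgue measure moves the shift into the density; completing
  the square leaves the likelihood ratio of the normal law with mean \<open>y\<close> against the
  centred one.\<close>

lemma nn_integral_std_normal_shift:
  assumes [measurable]: "f \<in> borel_measurable borel"
  shows "(\<integral>\<^sup>+x. f (x + y) \<partial>std_normal) = (\<integral>\<^sup>+x. f x * ennreal (exp (x * y - y\<^sup>2 / 2)) \<partial>std_normal)"
proof -
  have "(\<integral>\<^sup>+x. f (x + y) \<partial>std_normal) = (\<integral>\<^sup>+x. ennreal (std_normal_density x) * f (x + y) \<partial>lborel)"
    unfolding std_normal_def by (subst nn_integral_density) auto
  also have "\<dots> = (\<integral>\<^sup>+x. ennreal (std_normal_density (x - y)) * f x \<partial>lborel)"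
    by (subst (2) nn_integral_real_affine[where c=1 and t=y]) (auto simp: add.commute)
  also have "std_normal_density (x - y) = std_normal_density x * exp (x * y - y\<^sup>2 / 2)" for x
  proof -
    have "- (x - y)\<^sup>2 / 2 = - x\<^sup>2 / 2 + (x * y - y\<^sup>2 / 2)"
      by (simp add: power2_eq_square field_simps)
    hence "exp (- (x - y)\<^sup>2 / 2) = exp (- x\<^sup>2 / 2) * exp (x * y - y\<^sup>2 / 2)"
      by (simp only: exp_add)
    thus ?thesis by (simp add: std_normal_density_def)
  qed
  hence "(\<integral>\<^sup>+x. ennreal (std_normal_density (x - y)) * f x \<partial>lborel) =
     (\<integral>\<^sup>+x. ennreal (std_normal_density x) * (f x * ennreal (exp (x * y - y\<^sup>2 / 2))) \<partial>lborel)"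
    by (simp add: ennreal_mult mult_ac)
  also have "\<dots> = (\<integral>\<^sup>+x. f x * ennreal (exp (x * y - y\<^sup>2 / 2)) \<partial>std_normal)"
    unfolding std_normal_def by (subst nn_integral_density) auto
  finally show ?thesis .
qed

text \<open>The one-dimensional formula is applied to one coordinate at a time. The induction is
  over arbitrary \<open>f\<close>, since its hypothesis is used for \<open>f\<close> with the new
  coordinate frozen. The shifted point is restricted to \<open>I\<close> because points of the
  product space are extensional.\<close>

lemma nn_integral_gauss_shift:
  assumes "finite I" "f \<in> borel_measurable (gauss I)"
  shows "(\<integral>\<^sup>+x. f (\<lambda>i\<in>I. x i + y i) \<partial>gauss I) =
         (\<integral>\<^sup>+x. f x * ennreal (exp (\<Sum>i\<in>I. x i * y i - (y i)\<^sup>2 / 2)) \<partial>gauss I)"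
  using assms
proof (induction I arbitrary: f)
  case empty
  show ?case by (simp add: PiM_empty nn_integral_count_space_finite)
next
  case (insert i I)
  note [measurable] = insert.prems
  let ?e = "\<lambda>J x. ennreal (exp (\<Sum>i\<in>J. x i * y i - (y i)\<^sup>2 / 2))"
  have upd: "(\<lambda>z. z(i := a)) \<in> gauss I \<rightarrow>\<^sub>M gauss (insert i I)" for a
    by (rule measurable_fun_upd[where J=I]) auto
  have restr: "(\<lambda>j\<in>insert i I. (x(i := a)) j + y j) = (\<lambda>j\<in>I. x j + y j)(i := a + y i)" for x a
    using insert.hyps by (auto simp: fun_eq_iff)
  have e: "?e (insert i I) (x(i := a)) = ?e I x * ennreal (exp (a * y i - (y i)\<^sup>2 / 2))" for x a
  proof -
    have "(\<Sum>j\<in>I. (x(i := a)) j * y j - (y j)\<^sup>2 / 2) = (\<Sum>j\<in>I. x j * y j - (y j)\<^sup>2 / 2)"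
      using insert.hyps by (intro sum.cong) auto
    thus ?thesis using insert.hyps by (simp add: exp_add ennreal_mult' mult.commute)
  qed
  have "(\<integral>\<^sup>+x. f (\<lambda>j\<in>insert i I. x j + y j) \<partial>gauss (insert i I)) =
     (\<integral>\<^sup>+a. (\<integral>\<^sup>+x. f ((\<lambda>j\<in>I. x j + y j)(i := a + y i)) \<partial>gauss I) \<partial>std_normal)"
    by (subst gauss.product_nn_integral_insert_rev[OF insert.hyps]) (measurable, simp only: restr)
  also have "\<dots> = (\<integral>\<^sup>+a. (\<integral>\<^sup>+x. f (x(i := a + y i)) * ?e I x \<partial>gauss I) \<partial>std_normal)"
    using measurable_compose[OF upd insert.prems]
    by (intro nn_integral_cong insert.IH[of "\<lambda>x. f (x(i := _ + y i))"]) auto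
  also have "\<dots> = (\<integral>\<^sup>+a. (\<integral>\<^sup>+x. f (x(i := a)) * ?e I x \<partial>gauss I) * 
                      ennreal (exp (a * y i - (y i)\<^sup>2 / 2)) \<partial>std_normal)"
    using insert.hyps
    by (intro nn_integral_std_normal_shift[of "\<lambda>a. \<integral>\<^sup>+x. f (x(i := a)) * ?e I x \<partial>gauss I"]) measurable
  also have "\<dots> = (\<integral>\<^sup>+a. (\<integral>\<^sup>+x. f (x(i := a)) * ?e (insert i I) (x(i := a)) \<partial>gauss I) \<partial>std_normal)"
    unfolding e mult.assoc[symmetric]
    using measurable_compose[OF upd insert.prems] insert.hyps
    by (intro nn_integral_cong nn_integral_multc[symmetric]) measurable
  also have "\<dots> = (\<integral>\<^sup>+x. f x * ?e (insert i I) x \<partial>gauss (insert i I))"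
    using insert.hyps by (subst gauss.product_nn_integral_insert_rev) auto
  finally show ?case .
qed

text \<open>The translation formula for the constant function 1 says that the likelihood ratio
  integrates to 1; the quadratic part of its exponent is a constant factor.\<close>

lemma nn_integral_gauss_exp:
  assumes "finite I"
  shows "(\<integral>\<^sup>+x. ennreal (exp (\<Sum>i\<in>I. x i * y i)) \<partial>gauss I) = ennreal (exp (\<Sum>i\<in>I. (y i)\<^sup>2 / 2))"
proof -
  have "(\<integral>\<^sup>+x. ennreal (exp (\<Sum>i\<in>I. x i * y i)) \<partial>gauss I) =
    (\<integral>\<^sup>+x. ennreal (exp (\<Sum>i\<in>I. (y i)\<^sup>2 / 2)) * (1 * ennreal (exp (\<Sum>i\<in>I. x i * y i - (y i)\<^sup>2 / 2))) \<partial>gauss I)"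
    by (intro nn_integral_cong) (simp flip: ennreal_mult exp_add add: sum_subtractf)
  also have "\<dots> = ennreal (exp (\<Sum>i\<in>I. (y i)\<^sup>2 / 2)) * 1"
    using assms nn_integral_gauss_shift[of I "\<lambda>_. 1" y]
    by (subst nn_integral_cmult) (auto simp: gauss.P.emeasure_space_1)
  finally show ?thesis by simp
qed

lemma nn_integral_std_normal_exp:
  "(\<integral>\<^sup>+h. ennreal (exp (h * c)) \<partial>std_normal) = ennreal (exp (c\<^sup>2 / 2))"
proof -
  have "(\<integral>\<^sup>+h. ennreal (exp (h * c)) \<partial>std_normal) =
     (\<integral>\<^sup>+h. ennreal (exp (c\<^sup>2 / 2)) * (1 * ennreal (exp (h * c - c\<^sup>2 / 2))) \<partial>std_normal)"
    by (intro nn_integral_cong) (simp flip: ennreal_mult exp_add)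
  also have "\<dots> = ennreal (exp (c\<^sup>2 / 2)) * 1"
    using nn_integral_std_normal_shift[of "\<lambda>_. 1" c]
    by (subst nn_integral_cmult) 
      (auto simp: prob_space.emeasure_space_1[OF prob_space_std_normal, simplified])
  finally show ?thesis by simp
qed

text \<open>The factor halves the quadratic exponent, which turns the density into
  \<open>sqrt 2\<close> times that of variance 2.\<close>

lemma nn_integral_std_normal_exp_sq:
  "(\<integral>\<^sup>+x. ennreal (exp (x\<^sup>2 / 4)) \<partial>std_normal) = ennreal (sqrt 2)"
proof -
  have *: "std_normal_density x * exp (x\<^sup>2 / 4) = sqrt 2 * normal_density 0 (sqrt 2) x" for x
  proof -
    have "- x\<^sup>2 / 2 + x\<^sup>2 / 4 = - x\<^sup>2 / 4" by simp
    hence "exp (- x\<^sup>2 / 2) * exp (x\<^sup>2 / 4) = exp (- x\<^sup>2 / 4)" by (simp flip: exp_add)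
    thus ?thesis by (simp add: normal_density_def real_sqrt_mult field_simps)
  qed
  have "(\<integral>\<^sup>+x. ennreal (exp (x\<^sup>2 / 4)) \<partial>std_normal) =
     (\<integral>\<^sup>+x. ennreal (sqrt 2) * ennreal (normal_density 0 (sqrt 2) x) \<partial>lborel)"
    unfolding std_normal_def
    by (subst nn_integral_density) (auto simp: * simp flip: ennreal_mult intro!: nn_integral_cong)
  also have "\<dots> = ennreal (sqrt 2)"
    by (subst nn_integral_cmult) (auto simp: nn_integral_eq_integral)
  finally show ?thesis .
qed

text \<open>The linear form has variance \<open>\<Sum>i\<in>I. (u i)\<^sup>2\<close>, so after
  normalisation this is the one-dimensional moment. To get there the square is linearised:
  \<open>exp (s\<^sup>2 / 2)\<close> is the mean of \<open>exp (h * s)\<close> over a standard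
  normal \<open>h\<close>, and the two integrals are exchanged.\<close>

lemma nn_integral_gauss_exp_sq_le:
  assumes "finite I"
  shows "(\<integral>\<^sup>+x. ennreal (exp ((\<Sum>i\<in>I. u i * x i)\<^sup>2 / (4 * (\<Sum>i\<in>I. (u i)\<^sup>2)))) \<partial>gauss I) \<le> ennreal (sqrt 2)"
proof (cases "(\<Sum>i\<in>I. (u i)\<^sup>2) = 0")
  case True
  \<comment> \<open>Division by zero gives 0, so the integrand is 1 and the integral is 1, below
    \<open>sqrt 2\<close>.\<close>
  thus ?thesis by (simp add: gauss.P.emeasure_space_1)
next
  case False
  define v where "v = (\<Sum>i\<in>I. (u i)\<^sup>2)"
  have v: "v > 0" using False by (simp add: v_def less_le sum_nonneg)
  \<comment> \<open>This scaling makes half the squared form in \<open>w\<close> equal to the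
    exponent, and gives \<open>w\<close> squared length 1/2.\<close>
  define w where "w i = u i / sqrt (2 * v)" for i
  have w2: "(\<Sum>i\<in>I. (w i)\<^sup>2) = 1 / 2"
    using v by (simp add: w_def power_divide flip: sum_divide_distrib v_def)
  have "(\<integral>\<^sup>+x. ennreal (exp ((\<Sum>i\<in>I. u i * x i)\<^sup>2 / (4 * v))) \<partial>gauss I) =
        (\<integral>\<^sup>+x. (\<integral>\<^sup>+h. ennreal (exp (h * (\<Sum>i\<in>I. w i * x i))) \<partial>std_normal) \<partial>gauss I)"
  proof (intro nn_integral_cong)
    fix x
    have "(\<Sum>i\<in>I. u i * x i)\<^sup>2 / (4 * v) = (\<Sum>i\<in>I. w i * x i)\<^sup>2 / 2"
    proof -
      have "(\<Sum>i\<in>I. w i * x i) = (\<Sum>i\<in>I. u i * x i) / sqrt (2 * v)"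
        by (simp add: w_def sum_divide_distrib)
      thus ?thesis using v by (simp add: power_divide)
    qed
    thus "ennreal (exp ((\<Sum>i\<in>I. u i * x i)\<^sup>2 / (4 * v))) =
       (\<integral>\<^sup>+h. ennreal (exp (h * (\<Sum>i\<in>I. w i * x i))) \<partial>std_normal)"
      by (simp add: nn_integral_std_normal_exp)
  qed
  also have "\<dots> = (\<integral>\<^sup>+h. (\<integral>\<^sup>+x. ennreal (exp (h * (\<Sum>i\<in>I. w i * x i))) \<partial>gauss I) \<partial>std_normal)"
  proof -
    interpret pair_sigma_finite std_normal "gauss I"
      using prob_space_std_normal gauss.P.prob_space_axioms
      by (intro pair_sigma_finite.intro prob_space_imp_sigma_finite)
    show ?thesis by (rule Fubini') measurable
  qed
  also have "\<dots> = (\<integral>\<^sup>+h. ennreal (exp (h\<^sup>2 / 4)) \<partial>std_normal)"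
  proof (intro nn_integral_cong)
    fix h
    have "(\<integral>\<^sup>+x. ennreal (exp (h * (\<Sum>i\<in>I. w i * x i))) \<partial>gauss I) = 
          (\<integral>\<^sup>+x. ennreal (exp (\<Sum>i\<in>I. x i * (h * w i))) \<partial>gauss I)"
      by (simp add: sum_distrib_left mult_ac)
    also have "\<dots> = ennreal (exp (\<Sum>i\<in>I. (h * w i)\<^sup>2 / 2))"
      by (rule nn_integral_gauss_exp[OF assms])
    also have "(\<Sum>i\<in>I. (h * w i)\<^sup>2 / 2) = h\<^sup>2 / 4"
      using w2 by (simp add: power_mult_distrib flip: sum_divide_distrib sum_distrib_left)
    finally show "(\<integral>\<^sup>+x. ennreal (exp (h * (\<Sum>i\<in>I. w i * x i))) \<partial>gauss I) = ennreal (exp (h\<^sup>2 / 4))" .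
  qed
  finally show ?thesis by (simp add: nn_integral_std_normal_exp_sq v_def)
qed

text \<open>Jensen's inequality for weights that may sum to less than 1: the missing mass is put on
  an extra point \<open>None\<close> with value 0, where the exponential is 1.\<close>

lemma exp_convex_sum_le:
  fixes p x :: "'i \<Rightarrow> real"
  assumes "finite I" "\<And>i. i \<in> I \<Longrightarrow> p i \<ge> 0" "sum p I \<le> 1"
  shows "exp (\<Sum>i\<in>I. p i * x i) \<le> (1 - sum p I) + (\<Sum>i\<in>I. p i * exp (x i))"
proof -
  define q where "q j = (case j of None \<Rightarrow> 1 - sum p I | Some i \<Rightarrow> p i)" for j
  define z where "z j = (case j of None \<Rightarrow> 0 | Some i \<Rightarrow> x i)" for j
  have eq: "(\<Sum>j\<in>insert None (Some ` I). F j) = F None + (\<Sum>i\<in>I. F (Some i))" for F :: "_ \<Rightarrow> real"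
    using assms(1) by (subst sum.insert) (auto simp: sum.reindex)
  have "exp (\<Sum>j\<in>insert None (Some ` I). q j *\<^sub>R z j) \<le> (\<Sum>j\<in>insert None (Some ` I). q j * exp (z j))"
    using assms by (intro convex_on_sum[OF _ _ exp_convex]) (auto simp: q_def eq)
  thus ?thesis by (simp add: eq q_def z_def)
qed

text \<open>Integrating over \<open>y\<close> leaves the exponential of half the sum of the squared
  rows of \<open>W\<close> applied to \<open>x\<close>. Convexity bounds it by a weighted sum of
  exponentials with a single row each, and each of these has mean at most
  \<open>sqrt 2\<close>.\<close>

lemma nn_integral_gauss_bilinear_exp_le:
  fixes W :: "'i \<Rightarrow> 'i \<Rightarrow> real"
  assumes fin: "finite I" and W: "(\<Sum>k\<in>I. \<Sum>l\<in>I. (W k l)\<^sup>2) \<le> 1 / 2"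
  shows "(\<integral>\<^sup>+x. (\<integral>\<^sup>+y. ennreal (exp (\<Sum>k\<in>I. y k * (\<Sum>l\<in>I. W k l * x l))) \<partial>gauss I) \<partial>gauss I) \<le> 2"
proof -
  define v where "v k = (\<Sum>l\<in>I. (W k l)\<^sup>2)" for k
  \<comment> \<open>With this weight half the square of row \<open>k\<close> is \<open>p k\<close>
    times the exponent of \<open>nn_integral_gauss_exp_sq_le\<close>; the hypothesis on
    \<open>W\<close> is exactly that the weights sum to at most 1.\<close>
  define p where "p k = 2 * v k" for k
  have v0: "v k \<ge> 0" for k by (auto simp: v_def sum_nonneg)
  have sp: "sum p I \<le> 1" using W by (simp add: p_def v_def flip: sum_distrib_left)
  have s2: "sqrt 2 \<le> (2::real)" "1 \<le> sqrt (2::real)" by (auto simp: real_le_lsqrt)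
  have "(\<integral>\<^sup>+y. ennreal (exp (\<Sum>k\<in>I. y k * (\<Sum>l\<in>I. W k l * x l))) \<partial>gauss I) \<le>
        ennreal (1 - sum p I) + (\<Sum>k\<in>I. ennreal (p k) * ennreal (exp ((\<Sum>l\<in>I. W k l * x l)\<^sup>2 / (4 * v k))))" for x
  proof -
    have *: "(\<Sum>l\<in>I. W k l * x l)\<^sup>2 / 2 = p k * ((\<Sum>l\<in>I. W k l * x l)\<^sup>2 / (4 * v k))" for k
    \<comment> \<open>A row with zero variance vanishes, so both sides are 0 despite the division by
      zero.\<close>
    proof (cases "v k = 0")
      case True
      hence "\<forall>l\<in>I. W k l = 0" using fin by (auto simp: v_def sum_nonneg_eq_0_iff)
      thus ?thesis by simp
    qed (simp add: p_def)
    have "(\<integral>\<^sup>+y. ennreal (exp (\<Sum>k\<in>I. y k * (\<Sum>l\<in>I. W k l * x l))) \<partial>gauss I) =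
       ennreal (exp (\<Sum>k\<in>I. p k * ((\<Sum>l\<in>I. W k l * x l)\<^sup>2 / (4 * v k))))"
      by (subst nn_integral_gauss_exp[OF fin]) (simp add: *)
    also have "\<dots> \<le> ennreal ((1 - sum p I) + (\<Sum>k\<in>I. p k * exp ((\<Sum>l\<in>I. W k l * x l)\<^sup>2 / (4 * v k))))"
      using v0 sp fin by (intro ennreal_leI exp_convex_sum_le) (auto simp: p_def)
    also have "\<dots> = ennreal (1 - sum p I) + (\<Sum>k\<in>I. ennreal (p k * exp ((\<Sum>l\<in>I. W k l * x l)\<^sup>2 / (4 * v k))))"
      using v0 sp by (subst ennreal_plus) (auto simp: p_def sum_ennreal intro!: sum_nonneg)
    finally show ?thesis using v0 by (simp add: ennreal_mult p_def)
  qed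
  hence "(\<integral>\<^sup>+x. (\<integral>\<^sup>+y. ennreal (exp (\<Sum>k\<in>I. y k * (\<Sum>l\<in>I. W k l * x l))) \<partial>gauss I) \<partial>gauss I) \<le>
     (\<integral>\<^sup>+x. ennreal (1 - sum p I) + (\<Sum>k\<in>I. ennreal (p k) * ennreal (exp ((\<Sum>l\<in>I. W k l * x l)\<^sup>2 / (4 * v k)))) \<partial>gauss I)"
    by (intro nn_integral_mono)
  also have "\<dots> = ennreal (1 - sum p I) + (\<Sum>k\<in>I. ennreal (p k) * (\<integral>\<^sup>+x. ennreal (exp ((\<Sum>l\<in>I. W k l * x l)\<^sup>2 / (4 * v k))) \<partial>gauss I))"
    by (subst nn_integral_add) (auto simp: nn_integral_sum nn_integral_cmult gauss.P.emeasure_space_1)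
  also have "\<dots> \<le> ennreal (1 - sum p I) + (\<Sum>k\<in>I. ennreal (p k) * ennreal (sqrt 2))"
    unfolding v_def by (intro add_mono sum_mono mult_left_mono nn_integral_gauss_exp_sq_le fin) auto
  also have "\<dots> = ennreal (1 - sum p I + sum p I * sqrt 2)"
    using v0 sp by (subst ennreal_plus) (auto simp: p_def sum_distrib_right sum_ennreal 
       simp flip: ennreal_mult intro!: mult_nonneg_nonneg sum_nonneg)
  also have "\<dots> \<le> ennreal 2"
  proof (rule ennreal_leI)
    have "sum p I * (sqrt 2 - 1) \<le> 1 * (sqrt 2 - 1)" using sp s2 by (intro mult_right_mono) auto
    thus "1 - sum p I + sum p I * sqrt 2 \<le> 2" using s2 by (simp add: algebra_simps)
  qed
  finally show ?thesis by simp
qed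

text \<open>A matrix and its transpose have Gram matrices of equal Hilbert--Schmidt norm. This
  exchanges the Gram matrix over noise indices, which appears in the exponential moment, for the
  covariance over observation points, which can be computed.\<close>

lemma sum_gram_sq:
  fixes M :: "'d \<Rightarrow> 'g \<Rightarrow> real"
  shows "(\<Sum>k\<in>G. \<Sum>l\<in>G. (\<Sum>t\<in>D. M t k * M t l)\<^sup>2) = (\<Sum>s\<in>D. \<Sum>t\<in>D. (\<Sum>l\<in>G. M s l * M t l)\<^sup>2)"
proof -
  have "(\<Sum>k\<in>G. \<Sum>l\<in>G. (\<Sum>t\<in>D. M t k * M t l)\<^sup>2) =
     (\<Sum>k\<in>G. \<Sum>l\<in>G. \<Sum>s\<in>D. \<Sum>t\<in>D. (M s k * M s l) * (M t k * M t l))"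
    by (simp add: power2_eq_square sum_product)
  also have "\<dots> = (\<Sum>k\<in>G. \<Sum>s\<in>D. \<Sum>t\<in>D. \<Sum>l\<in>G. (M s k * M s l) * (M t k * M t l))"
    by (subst sum.swap[of _ D G], subst sum.swap[of _ D G]) (rule refl)
  also have "\<dots> = (\<Sum>s\<in>D. \<Sum>t\<in>D. \<Sum>k\<in>G. \<Sum>l\<in>G. (M s k * M s l) * (M t k * M t l))"
    by (subst sum.swap[of _ D G], subst sum.swap[of _ D G]) (rule refl)
  also have "\<dots> = (\<Sum>s\<in>D. \<Sum>t\<in>D. (\<Sum>l\<in>G. M s l * M t l)\<^sup>2)"
    by (simp add: power2_eq_square sum_product mult_ac)
  finally show ?thesis .
qed

text \<open>
  The second moment of the likelihood ratio between a Gaussian mixture of shifts and white noise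
  is the exponential moment of the inner product of two independent shifts.
\<close>

lemma gauss_mixture_le:
  fixes M :: "'d \<Rightarrow> 'g \<Rightarrow> real"
  assumes fin: "finite D" "finite G" and A[measurable]: "A \<in> sets (gauss D)"
    and M: "(\<Sum>s\<in>D. \<Sum>t\<in>D. (\<Sum>l\<in>G. M s l * M t l)\<^sup>2) \<le> 1 / 2"
  shows "(\<integral>\<^sup>+z. (\<integral>\<^sup>+x. indicator A (\<lambda>t\<in>D. x t + (\<Sum>l\<in>G. M t l * z l)) \<partial>gauss D) \<partial>gauss G)\<^sup>2
           \<le> 2 * emeasure (gauss D) A"
proof -
  interpret GD: pair_sigma_finite "gauss G" "gauss D"
    by (intro pair_sigma_finite.intro prob_space_imp_sigma_finite gauss.P.prob_space_axioms)
  define y where "y z t = (\<Sum>l\<in>G. M t l * z l)" for z t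
  have [measurable]: "(\<lambda>z. y z t) \<in> borel_measurable (gauss G)" for t by (simp add: y_def)
  \<comment> \<open>The likelihood ratio at \<open>x\<close> of white noise shifted by
    \<open>y z\<close>.\<close>
  define q where "q z x = ennreal (exp (\<Sum>t\<in>D. x t * y z t - (y z t)\<^sup>2 / 2))" for z x
  have [measurable]: "(\<lambda>(z, x). q z x) \<in> borel_measurable (gauss G \<Otimes>\<^sub>M gauss D)"
    unfolding q_def by measurable
  have [measurable]: "(\<lambda>(x, z). q z x) \<in> borel_measurable (gauss D \<Otimes>\<^sub>M gauss G)"
    unfolding q_def by measurable
  have "(\<integral>\<^sup>+z. (\<integral>\<^sup>+x. indicator A (\<lambda>t\<in>D. x t + y z t) \<partial>gauss D) \<partial>gauss G) =
        (\<integral>\<^sup>+z. (\<integral>\<^sup>+x. indicator A x * q z x \<partial>gauss D) \<partial>gauss G)"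
    unfolding q_def using fin by (intro nn_integral_cong nn_integral_gauss_shift) auto
  also have "\<dots> = (\<integral>\<^sup>+x. (\<integral>\<^sup>+z. indicator A x * q z x \<partial>gauss G) \<partial>gauss D)"
    by (rule GD.Fubini'[symmetric]) measurable
  also have "\<dots> = (\<integral>\<^sup>+x. indicator A x * (\<integral>\<^sup>+z. q z x \<partial>gauss G) \<partial>gauss D)"
    by (intro nn_integral_cong nn_integral_cmult) measurable
  finally have "(\<integral>\<^sup>+z. (\<integral>\<^sup>+x. indicator A (\<lambda>t\<in>D. x t + y z t) \<partial>gauss D) \<partial>gauss G)\<^sup>2 =
     (\<integral>\<^sup>+x. indicator A x * (\<integral>\<^sup>+z. q z x \<partial>gauss G) \<partial>gauss D)\<^sup>2" by simp
  \<comment> \<open>The Cauchy--Schwarz inequality separates the event from the mixture likelihood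
    ratio, whose second moment remains to be bounded by 2.\<close>
  also have "\<dots> \<le> (\<integral>\<^sup>+x. (indicator A x)\<^sup>2 \<partial>gauss D) * (\<integral>\<^sup>+x. (\<integral>\<^sup>+z. q z x \<partial>gauss G)\<^sup>2 \<partial>gauss D)"
    by (intro Cauchy_Schwarz_nn_integral) measurable
  also have "(\<integral>\<^sup>+x. (indicator A x)\<^sup>2 \<partial>gauss D) = (\<integral>\<^sup>+x. indicator A x \<partial>gauss D)"
    by (intro nn_integral_cong) (auto simp: indicator_def)
  also have "\<dots> = emeasure (gauss D) A" by simp
  also have "\<dots> * (\<integral>\<^sup>+x. (\<integral>\<^sup>+z. q z x \<partial>gauss G)\<^sup>2 \<partial>gauss D) \<le> \<dots> * 2"
  proof (rule mult_left_mono)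
    define W where "W k l = (\<Sum>t\<in>D. M t k * M t l)" for k l
    \<comment> \<open>In the mean of the product of two likelihood ratios the squares of the shifts
      cancel and only their inner product survives.\<close>
    have qq: "(\<integral>\<^sup>+x. q z x * q w x \<partial>gauss D) = ennreal (exp (\<Sum>t\<in>D. y z t * y w t))" for z w
    proof -
      have "(\<integral>\<^sup>+x. q z x * q w x \<partial>gauss D) =
         (\<integral>\<^sup>+x. ennreal (exp (- (\<Sum>t\<in>D. (y z t)\<^sup>2 / 2 + (y w t)\<^sup>2 / 2))) * 
             ennreal (exp (\<Sum>t\<in>D. x t * (y z t + y w t))) \<partial>gauss D)"
        unfolding q_def
        by (intro nn_integral_cong)
           (simp flip: ennreal_mult exp_add sum.distrib sum_negf add: algebra_simps)
      also have "\<dots> = ennreal (exp (- (\<Sum>t\<in>D. (y z t)\<^sup>2 / 2 + (y w t)\<^sup>2 / 2))) *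
                       ennreal (exp (\<Sum>t\<in>D. (y z t + y w t)\<^sup>2 / 2))"
        by (subst nn_integral_cmult) (auto simp: nn_integral_gauss_exp[OF fin(1)])
      also have "\<dots> = ennreal (exp (\<Sum>t\<in>D. - ((y z t)\<^sup>2 / 2 + (y w t)\<^sup>2 / 2) + (y z t + y w t)\<^sup>2 / 2))"
        by (simp only: sum.distrib sum_negf exp_add ennreal_mult[OF exp_ge_zero exp_ge_zero])
      also have "(\<Sum>t\<in>D. - ((y z t)\<^sup>2 / 2 + (y w t)\<^sup>2 / 2) + (y z t + y w t)\<^sup>2 / 2) = (\<Sum>t\<in>D. y z t * y w t)"
        by (intro sum.cong) (auto simp: power2_eq_square field_simps)
      finally show ?thesis .
    qed
    \<comment> \<open>The square of the mixture is written with two independent copies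
      \<open>z\<close> and \<open>w\<close>, so that \<open>x\<close> can be integrated
      first.\<close>
    have "(\<integral>\<^sup>+x. (\<integral>\<^sup>+z. q z x \<partial>gauss G)\<^sup>2 \<partial>gauss D) = 
          (\<integral>\<^sup>+x. (\<integral>\<^sup>+z. (\<integral>\<^sup>+w. q z x * q w x \<partial>gauss G) \<partial>gauss G) \<partial>gauss D)"
      unfolding power2_eq_square
      by (intro nn_integral_cong, subst nn_integral_multc[symmetric], measurable,
          intro nn_integral_cong nn_integral_cmult[symmetric]) measurable
    also have "\<dots> = (\<integral>\<^sup>+z. (\<integral>\<^sup>+x. (\<integral>\<^sup>+w. q z x * q w x \<partial>gauss G) \<partial>gauss D) \<partial>gauss G)"
      by (rule GD.Fubini') measurable
    also have "\<dots> = (\<integral>\<^sup>+z. (\<integral>\<^sup>+w. (\<integral>\<^sup>+x. q z x * q w x \<partial>gauss D) \<partial>gauss G) \<partial>gauss G)"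
      by (intro nn_integral_cong GD.Fubini') measurable
    also have "\<dots> = (\<integral>\<^sup>+z. (\<integral>\<^sup>+w. ennreal (exp (\<Sum>k\<in>G. w k * (\<Sum>l\<in>G. W k l * z l))) \<partial>gauss G) \<partial>gauss G)"
    proof (intro nn_integral_cong)
      fix z w
      have "(\<Sum>t\<in>D. y z t * y w t) = (\<Sum>t\<in>D. \<Sum>k\<in>G. \<Sum>l\<in>G. M t k * w k * (M t l * z l))"
        unfolding y_def by (subst mult.commute) (simp only: sum_product)
      also have "\<dots> = (\<Sum>k\<in>G. \<Sum>l\<in>G. \<Sum>t\<in>D. M t k * w k * (M t l * z l))"
        by (subst sum.swap[of _ D G], subst sum.swap[of _ D G]) (rule refl)
      also have "\<dots> = (\<Sum>k\<in>G. w k * (\<Sum>l\<in>G. W k l * z l))"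
        by (simp add: W_def sum_distrib_left sum_distrib_right mult_ac)
      finally show "(\<integral>\<^sup>+x. q z x * q w x \<partial>gauss D) = ennreal (exp (\<Sum>k\<in>G. w k * (\<Sum>l\<in>G. W k l * z l)))"
        by (simp add: qq)
    qed
    also have "\<dots> \<le> 2"
      using M by (intro nn_integral_gauss_bilinear_exp_le fin) (simp only: W_def sum_gram_sq[where M = M and D = D and G = G])
    finally show "(\<integral>\<^sup>+x. (\<integral>\<^sup>+z. q z x \<partial>gauss G)\<^sup>2 \<partial>gauss D) \<le> 2" .
  qed simp
  finally show ?thesis by (simp only: y_def mult.commute[of 2])
qed

text \<open>\<open>D\<close> carries the white noise, \<open>G\<close> the noise of the new layer
  and \<open>R\<close> that of the earlier layers. Given the noise on \<open>R\<close>, the term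
  \<open>r\<close> is a fixed shift that can be absorbed into the event, so
  \<open>gauss_mixture_le\<close> applies conditionally.\<close>

lemma gauss_perturbation_le:
  fixes M :: "'i \<Rightarrow> 'i \<Rightarrow> real" and r :: "'i \<Rightarrow> ('i \<Rightarrow> real) \<Rightarrow> real"
  assumes fin: "finite D" "finite G" "finite R" 
    and disj: "D \<inter> G = {}" "D \<inter> R = {}" "G \<inter> R = {}"
    and A[measurable]: "A \<in> sets (gauss D)"
    and r[measurable]: "\<And>t. r t \<in> borel_measurable (gauss R)"
    and M: "(\<Sum>s\<in>D. \<Sum>t\<in>D. (\<Sum>l\<in>G. M s l * M t l)\<^sup>2) \<le> 1 / 2"
  shows "(\<integral>\<^sup>+\<omega>. indicator A (\<lambda>t\<in>D. \<omega> t + r t (restrict \<omega> R) + (\<Sum>l\<in>G. M t l * \<omega> l)) \<partial>gauss (R \<union> (G \<union> D)))\<^sup>2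
         \<le> 2 * (\<integral>\<^sup>+\<omega>. indicator A (\<lambda>t\<in>D. \<omega> t + r t (restrict \<omega> R)) \<partial>gauss (R \<union> (G \<union> D)))"
proof -
  \<comment> \<open>The event \<open>A\<close> translated back by the shift that the earlier layers
    produce.\<close>
  define B where "B u = {x \<in> space (gauss D). (\<lambda>t\<in>D. x t + r t u) \<in> A}" for u
  have B[measurable]: "B u \<in> sets (gauss D)" if "u \<in> space (gauss R)" for u
    unfolding B_def by measurable
  have iB: "indicator A (\<lambda>t\<in>D. x t + r t u + v t) = (indicator (B u) (\<lambda>t\<in>D. x t + v t) :: ennreal)" for x u v
  proof -
    have "(\<lambda>t\<in>D. x t + r t u + v t) = (\<lambda>t\<in>D. (\<lambda>t\<in>D. x t + v t) t + r t u)"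
      by (auto simp: fun_eq_iff)
    thus ?thesis by (auto simp: indicator_def B_def space_PiM)
  qed
  let ?F = "\<lambda>u. \<integral>\<^sup>+z. (\<integral>\<^sup>+x. indicator A (\<lambda>t\<in>D. x t + r t u + (\<Sum>l\<in>G. M t l * z l)) \<partial>gauss D) \<partial>gauss G"
  have fold: "(\<integral>\<^sup>+\<omega>. f \<omega> \<partial>gauss (R \<union> (G \<union> D))) =
      (\<integral>\<^sup>+u. (\<integral>\<^sup>+z. (\<integral>\<^sup>+x. f (merge R (G \<union> D) (u, merge G D (z, x))) \<partial>gauss D) \<partial>gauss G) \<partial>gauss R)"
    if [measurable]: "f \<in> borel_measurable (gauss (R \<union> (G \<union> D)))" for f
    using fin disj
    by (subst gauss.product_nn_integral_fold)
       (auto intro!: nn_integral_cong gauss.product_nn_integral_fold)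
  have merge_R [simp]: "restrict (merge R (G \<union> D) (u, w)) R = u" if "u \<in> space (gauss R)" for u w
    using that by (auto simp: fun_eq_iff merge_def restrict_def space_PiM PiE_def extensional_def)
  have "(\<integral>\<^sup>+\<omega>. indicator A (\<lambda>t\<in>D. \<omega> t + r t (restrict \<omega> R) + (\<Sum>l\<in>G. M t l * \<omega> l)) \<partial>gauss (R \<union> (G \<union> D)))
     = (\<integral>\<^sup>+u. ?F u \<partial>gauss R)"
  proof (subst fold)
    have e: "(\<lambda>t\<in>D. merge R (G \<union> D) (u, merge G D (z, x)) t + r t u + 
              (\<Sum>l\<in>G. M t l * merge R (G \<union> D) (u, merge G D (z, x)) l)) =
            (\<lambda>t\<in>D. x t + r t u + (\<Sum>l\<in>G. M t l * z l))" for u z x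
    proof (intro restrict_ext arg_cong2[where f="(+)"] sum.cong refl)
      show "merge R (G \<union> D) (u, merge G D (z, x)) t = x t" if "t \<in> D" for t
        using that disj by (auto simp: merge_def)
      show "M t l * merge R (G \<union> D) (u, merge G D (z, x)) l = M t l * z l" if "l \<in> G" for t l
        using that disj by (auto simp: merge_def)
    qed
    show "(\<integral>\<^sup>+u. \<integral>\<^sup>+z. \<integral>\<^sup>+x. indicator A (\<lambda>t\<in>D. merge R (G \<union> D) (u, merge G D (z, x)) t +
            r t (restrict (merge R (G \<union> D) (u, merge G D (z, x))) R) +
           (\<Sum>l\<in>G. M t l * merge R (G \<union> D) (u, merge G D (z, x)) l)) \<partial>gauss D \<partial>gauss G \<partial>gauss R) = 
         (\<integral>\<^sup>+u. ?F u \<partial>gauss R)"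
      by (intro nn_integral_cong) (simp add: e cong: restrict_cong)
  qed measurable
  \<comment> \<open>The factor 1 prepares a Cauchy--Schwarz step that moves the square inside the
    mean over \<open>R\<close>, a probability measure.\<close>
  also have "(\<integral>\<^sup>+u. ?F u \<partial>gauss R)\<^sup>2 = (\<integral>\<^sup>+u. ?F u * 1 \<partial>gauss R)\<^sup>2" by simp
  also have "\<dots> \<le> (\<integral>\<^sup>+u. (?F u)\<^sup>2 \<partial>gauss R) * (\<integral>\<^sup>+u. 1\<^sup>2 \<partial>gauss R)"
    by (intro Cauchy_Schwarz_nn_integral) measurable
  also have "\<dots> = (\<integral>\<^sup>+u. (?F u)\<^sup>2 \<partial>gauss R)"
    by (simp add: gauss.P.emeasure_space_1)
  also have "\<dots> \<le> (\<integral>\<^sup>+u. 2 * emeasure (gauss D) (B u) \<partial>gauss R)"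
    unfolding iB by (intro nn_integral_mono gauss_mixture_le fin B M)
  also have "\<dots> = (\<integral>\<^sup>+u. 2 * (\<integral>\<^sup>+x. indicator A (\<lambda>t\<in>D. x t + r t u) \<partial>gauss D) \<partial>gauss R)"
  proof (intro nn_integral_cong arg_cong2[where f="(*)"] refl)
    fix u assume u: "u \<in> space (gauss R)"
    have "emeasure (gauss D) (B u) = (\<integral>\<^sup>+x. indicator (B u) x \<partial>gauss D)"
      using B[OF u] by simp
    also have "\<dots> = (\<integral>\<^sup>+x. indicator A (\<lambda>t\<in>D. x t + r t u) \<partial>gauss D)"
      by (intro nn_integral_cong) (auto simp: B_def indicator_def)
    finally show "emeasure (gauss D) (B u) = (\<integral>\<^sup>+x. indicator A (\<lambda>t\<in>D. x t + r t u) \<partial>gauss D)" .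
  qed
  also have "\<dots> = 2 * (\<integral>\<^sup>+u. (\<integral>\<^sup>+x. indicator A (\<lambda>t\<in>D. x t + r t u) \<partial>gauss D) \<partial>gauss R)"
    by (intro nn_integral_cmult) measurable
  also have "(\<integral>\<^sup>+u. (\<integral>\<^sup>+x. indicator A (\<lambda>t\<in>D. x t + r t u) \<partial>gauss D) \<partial>gauss R) =
     (\<integral>\<^sup>+\<omega>. indicator A (\<lambda>t\<in>D. \<omega> t + r t (restrict \<omega> R)) \<partial>gauss (R \<union> (G \<union> D)))"
  proof (subst fold)
    have "(\<lambda>t\<in>D. merge R (G \<union> D) (u, merge G D (z, x)) t + r t u) = (\<lambda>t\<in>D. x t + r t u)" for u z x
      using disj by (intro restrict_ext) (auto simp: merge_def)
    thus "(\<integral>\<^sup>+u. (\<integral>\<^sup>+x. indicator A (\<lambda>t\<in>D. x t + r t u) \<partial>gauss D) \<partial>gauss R) =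
       (\<integral>\<^sup>+u. \<integral>\<^sup>+z. \<integral>\<^sup>+x. indicator A (\<lambda>t\<in>D. merge R (G \<union> D) (u, merge G D (z, x)) t +
            r t (restrict (merge R (G \<union> D) (u, merge G D (z, x))) R)) \<partial>gauss D \<partial>gauss G \<partial>gauss R)"
      by (intro nn_integral_cong) (simp add: merge_R gauss.P.emeasure_space_1 cong: restrict_cong)
  qed measurable
  finally show ?thesis .
qed

section \<open>Rank-one operators\<close>

lemma scaleC_zero_left [simp]: "0 *\<^sub>C (x::'h::complex_hilbert) = 0"
  using scaleR_scaleC[of 0 x] by simp

lemma scaleC_zero_right [simp]: "c *\<^sub>C (0::'h::complex_hilbert) = 0"
  using scaleC_add_right[of c "0::'h" 0] by simp

lemma scaleC_minus_left: "(- c) *\<^sub>C (x::'h::complex_hilbert) = - (c *\<^sub>C x)"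
  using scaleC_add_left[of c "- c" x] by (simp add: minus_unique)

lemma scaleC_diff_left: "(a - b) *\<^sub>C (x::'h::complex_hilbert) = a *\<^sub>C x - b *\<^sub>C x"
  using scaleC_add_left[of a "- b" x] by (simp add: scaleC_minus_left)

lemma scaleC_sum_left: "(\<Sum>i\<in>I. c i) *\<^sub>C (x::'h::complex_hilbert) = (\<Sum>i\<in>I. c i *\<^sub>C x)"
  by (induction I rule: infinite_finite_induct) (auto simp: scaleC_add_left)

lemma cinner_add_right: "cinner (x::'h::complex_hilbert) (y + z) = cinner x y + cinner x z"
  by (metis cinner_add_left cinner_commute complex_cnj_add)

lemma cinner_scaleC_right: "cinner (x::'h::complex_hilbert) (c *\<^sub>C y) = cnj c * cinner x y"
  by (metis cinner_commute cinner_scaleC_left complex_cnj_mult)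

lemma cinner_zero_left [simp]: "cinner (0::'h::complex_hilbert) x = 0"
  using cinner_scaleC_left[of 0 "0::'h" x] by simp

lemma cinner_zero_right [simp]: "cinner (x::'h::complex_hilbert) 0 = 0"
  using cinner_scaleC_right[of x 0 0] by simp

lemma cinner_minus_left: "cinner (- x::'h::complex_hilbert) y = - cinner x y"
  using cinner_add_left[of x "- x" y] by (simp add: minus_unique)

lemma cinner_minus_right: "cinner (x::'h::complex_hilbert) (- y) = - cinner x y"
  using cinner_add_right[of x y "- y"] by (simp add: minus_unique)

lemma cinner_diff_left: "cinner (x - y::'h::complex_hilbert) z = cinner x z - cinner y z"
  using cinner_add_left[of x "- y" z] by (simp add: cinner_minus_left)

lemma cinner_diff_right: "cinner (x::'h::complex_hilbert) (y - z) = cinner x y - cinner x z"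
  using cinner_add_right[of x y "- z"] by (simp add: cinner_minus_right)

lemma cinner_scaleR_left: "cinner (r *\<^sub>R (x::'h::complex_hilbert)) y = of_real r * cinner x y"
  by (simp add: scaleR_scaleC cinner_scaleC_left)

lemma cinner_self_eq_0: "cinner (x::'h::complex_hilbert) x = 0 \<longleftrightarrow> x = 0"
  by (simp add: cinner_self)

lemma cinner_ext:
  fixes x y :: "'h::complex_hilbert"
  assumes "\<And>z. cinner z x = cinner z y"
  shows "x = y"
proof -
  have "cinner (x - y) (x - y) = 0" by (simp only: cinner_diff_right assms diff_self)
  thus ?thesis by (simp add: cinner_self_eq_0)
qed

lemma norm_scaleC: "norm (c *\<^sub>C (x::'h::complex_hilbert)) = cmod c * norm x"
proof -
  have "complex_of_real ((norm (c *\<^sub>C x))\<^sup>2) = (c * cnj c) * of_real ((norm x)\<^sup>2)"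
    unfolding cinner_self[symmetric] by (simp add: cinner_scaleC_left cinner_scaleC_right)
  also have "\<dots> = of_real ((cmod c * norm x)\<^sup>2)"
    by (simp add: complex_norm_square power_mult_distrib del: of_real_power)
  finally have "(norm (c *\<^sub>C x))\<^sup>2 = (cmod c * norm x)\<^sup>2"
    by (simp only: of_real_eq_iff)
  thus ?thesis by (simp add: power2_eq_iff_nonneg)
qed

text \<open>The residual of the projection onto \<open>e\<close> has a nonnegative squared norm, by
  Pythagoras the difference of the two squares.\<close>

lemma cmod_cinner_unit_le:
  fixes e z :: "'h::complex_hilbert"
  assumes e: "cinner e e = 1"
  shows "cmod (cinner z e) \<le> norm z"
proof -
  let ?w = "z - cinner z e *\<^sub>C e"
  have "complex_of_real ((norm ?w)\<^sup>2) = cinner ?w ?w" by (simp add: cinner_self)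
  also have "\<dots> = cinner z z - cinner z e * cnj (cinner z e)"
    using e cinner_commute[of e z]
    by (simp add: cinner_diff_left cinner_diff_right cinner_scaleC_left cinner_scaleC_right)
  also have "\<dots> = of_real ((norm z)\<^sup>2 - (cmod (cinner z e))\<^sup>2)"
    by (simp add: cinner_self complex_norm_square del: of_real_power)
  finally have "(norm ?w)\<^sup>2 = (norm z)\<^sup>2 - (cmod (cinner z e))\<^sup>2"
    by (simp only: of_real_eq_iff)
  hence "(cmod (cinner z e))\<^sup>2 \<le> (norm z)\<^sup>2" by (metis diff_ge_0_iff_ge zero_le_power2)
  thus ?thesis by (rule power2_le_imp_le) simp
qed

lemma norm_eq_1_if_cinner:
  assumes "cinner e e = 1"
  shows "norm (e::'h::complex_hilbert) = 1"
proof -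
  have "complex_of_real ((norm e)\<^sup>2) = of_real 1" using assms cinner_self[of e] by simp
  hence "(norm e)\<^sup>2 = 1" by (simp only: of_real_eq_iff)
  thus ?thesis using norm_ge_zero[of e] by (simp add: power2_eq_1_iff)
qed

text \<open>This is \<open>c\<close> times \<open>e \<otimes>\<^sub>H e\<close>. All autocovariances
  and spectral densities constructed below take values of this form, so operator norms reduce to
  absolute values of scalars.\<close>

definition rank_one :: "'h::complex_hilbert \<Rightarrow> complex \<Rightarrow> 'h \<Rightarrow> 'h" where
  "rank_one e c z = (c * cinner z e) *\<^sub>C e"

lemma bounded_clinear_rank_one:
  assumes "cinner e e = 1"
  shows "bounded_clinear (rank_one e c)"
proof -
  have [simp]: "norm e = 1" using assms by (rule norm_eq_1_if_cinner)
  have "bounded_linear (rank_one e c)"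
  proof (rule bounded_linear_intro[where K="cmod c"])
    show "rank_one e c (x + y) = rank_one e c x + rank_one e c y" for x y
      by (simp add: rank_one_def cinner_add_left distrib_left scaleC_add_left)
    show "rank_one e c (r *\<^sub>R x) = r *\<^sub>R rank_one e c x" for r x
      by (simp add: rank_one_def scaleR_scaleC cinner_scaleC_left scaleC_scaleC mult_ac)
    show "norm (rank_one e c x) \<le> norm x * cmod c" for x
      using mult_left_mono[OF cmod_cinner_unit_le[OF assms, of x], of "cmod c"]
      by (simp add: rank_one_def norm_scaleC norm_mult mult.commute)
  qed
  thus ?thesis
    by (simp add: bounded_clinear_def rank_one_def cinner_scaleC_left scaleC_scaleC mult_ac)
qed

text \<open>Polarisation: reality of the quadratic form at \<open>x + y\<close> fixes the imaginary
  part, and at \<open>x + \<i> *\<^sub>C y\<close> the real part.\<close>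

lemma positive_op_self_adjoint:
  fixes B :: "'h::complex_hilbert \<Rightarrow> 'h"
  assumes "positive_op B"
  shows "cinner (B x) y = cinner x (B y)"
proof -
  have add: "B (x + y) = B x + B y" for x y
    using assms by (auto simp: positive_op_def bounded_clinear_def linear_add bounded_linear.linear)
  have sc: "B (c *\<^sub>C x) = c *\<^sub>C B x" for c x
    using assms by (auto simp: positive_op_def bounded_clinear_def)
  have real: "Im (cinner (B x) x) = 0" for x
    using assms by (auto simp: positive_op_def complex_is_Real_iff)
  have *: "Im (cinner (B x) y) + Im (cinner (B y) x) = 0" for x y
    using real[of "x + y"] real[of x] real[of y] by (simp add: add cinner_add_left cinner_add_right)
  have im: "Im (cinner (B x) y) = - Im (cinner (B y) x)"
    using *[of x y] by simp
  moreover have "Re (cinner (B x) y) = Re (cinner (B y) x)"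
    using *[of x "\<i> *\<^sub>C y"] by (simp add: sc cinner_scaleC_left cinner_scaleC_right)
  ultimately have "cinner (B x) y = cnj (cinner (B y) x)"
    by (simp add: complex_eq_iff)
  thus ?thesis using cinner_commute by metis
qed

text \<open>Since \<open>cadjoint\<close> is a choice, uniqueness has to be shown as well; it
  follows from nondegeneracy of the inner product.\<close>

lemma cadjoint_rank_one_real:
  "cadjoint (rank_one e (complex_of_real c)) = rank_one e (complex_of_real c)"
  unfolding cadjoint_def
proof (rule some_equality)
  show adj: "\<forall>x y. cinner (rank_one e (complex_of_real c) x) y = cinner x (rank_one e (complex_of_real c) y)"
  proof (intro allI)
    fix x y
    show "cinner (rank_one e (complex_of_real c) x) y = cinner x (rank_one e (complex_of_real c) y)"
      using cinner_commute[of e y] by (simp add: rank_one_def cinner_scaleC_left cinner_scaleC_right)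
  qed
  fix A' assume A': "\<forall>x y. cinner (rank_one e (complex_of_real c) x) y = cinner x (A' y)"
  show "A' = rank_one e (complex_of_real c)"
  proof (rule ext, rule cinner_ext)
    show "cinner x (A' y) = cinner x (rank_one e (complex_of_real c) y)" for x y
      using adj[rule_format, of x y] A'[rule_format, of x y] by simp
  qed
qed

text \<open>Since \<open>op_abs\<close> is a definite description, the positive square root must be
  shown unique. A candidate \<open>B\<close> kills the complement of \<open>e\<close>, because the
  squared norm of \<open>B z\<close> is \<open>cinner (B (B z)) z\<close>; by self-adjointness it
  then maps \<open>e\<close> to a multiple \<open>l\<close> of itself, where \<open>l\<close> is
  nonnegative with square \<open>c\<^sup>2\<close>.\<close>

lemma op_abs_rank_one_real:
  fixes e :: "'h::complex_hilbert"
  assumes e: "cinner e e = 1"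
  shows "op_abs (rank_one e (complex_of_real c)) = rank_one e (complex_of_real \<bar>c\<bar>)"
proof -
  have comp: "rank_one e a \<circ> rank_one e b = rank_one e (a * b)" for a b
    using e by (auto simp: rank_one_def cinner_scaleC_left mult_ac)
  have sq: "rank_one e (complex_of_real c) \<circ> rank_one e (complex_of_real c) = rank_one e (of_real (c\<^sup>2))"
    by (simp add: comp power2_eq_square)
  have quad: "cinner (rank_one e (complex_of_real a) x) x = of_real (a * (cmod (cinner x e))\<^sup>2)" for a x
    using cinner_commute[of e x] by (simp add: rank_one_def cinner_scaleC_left complex_norm_square del: of_real_power)
  have pos: "positive_op (rank_one e (complex_of_real \<bar>c\<bar>))"
    unfolding positive_op_def quad using bounded_clinear_rank_one[OF e] by auto
  have "op_abs (rank_one e (complex_of_real c)) = (THE B. positive_op B \<and> B \<circ> B = rank_one e (of_real (c\<^sup>2)))"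
    unfolding op_abs_def cadjoint_rank_one_real sq ..
  also have "\<dots> = rank_one e (complex_of_real \<bar>c\<bar>)"
  proof (rule the_equality)
    show "positive_op (rank_one e (complex_of_real \<bar>c\<bar>)) \<and>
       rank_one e (complex_of_real \<bar>c\<bar>) \<circ> rank_one e (complex_of_real \<bar>c\<bar>) = rank_one e (complex_of_real (c\<^sup>2))"
      using pos by (simp add: comp power2_eq_square flip: of_real_mult)
    fix B assume B: "positive_op B \<and> B \<circ> B = rank_one e (of_real (c\<^sup>2))"
    hence BB: "B (B x) = rank_one e (of_real (c\<^sup>2)) x" for x by (metis comp_apply)
    have sa: "cinner (B x) y = cinner x (B y)" for x y
      using B positive_op_self_adjoint by blast
    have add: "B (x + y) = B x + B y" and sc: "B (a *\<^sub>C x) = a *\<^sub>C B x" for a x y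
      using B by (auto simp: positive_op_def bounded_clinear_def linear_add bounded_linear.linear)
    have ker: "B z = 0" if "cinner z e = 0" for z
    proof -
      have "cinner (B z) (B z) = cinner (B (B z)) z" by (simp add: sa)
      also have "\<dots> = 0" by (simp add: BB rank_one_def that)
      finally show ?thesis by (simp add: cinner_self_eq_0)
    qed
    define l where "l = cinner (B e) e"
    have proj: "cinner (z - cinner z e *\<^sub>C e) e = 0" for z
      by (simp add: cinner_diff_left cinner_scaleC_left e)
    have Be: "B e = l *\<^sub>C e"
    proof -
      let ?w = "B e - l *\<^sub>C e"
      \<comment> \<open>The component of \<open>B e\<close> orthogonal to \<open>e\<close> lies in
        the kernel of \<open>B\<close>, so pairing it with \<open>B e\<close> gives 0.\<close>
      have w: "cinner ?w e = 0" using proj[of "B e"] by (simp add: l_def)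
      have "cinner ?w ?w = cinner (B e) ?w - l * cinner e ?w"
        by (simp add: cinner_diff_left cinner_scaleC_left)
      also have "cinner (B e) ?w = cinner e (B ?w)" by (rule sa)
      also have "\<dots> = 0" using ker[OF w] by simp
      also have "cinner e ?w = 0" using w cinner_commute[of e ?w] by simp
      finally show ?thesis by (simp add: cinner_self_eq_0)
    qed
    have l: "l \<in> \<real>" "Re l \<ge> 0" using B by (auto simp: positive_op_def l_def)
    have "l * l = of_real (c\<^sup>2)"
    proof -
      have "cinner (B (B e)) e = l * l" by (simp add: Be sc scaleC_scaleC cinner_scaleC_left e)
      thus ?thesis by (simp add: BB rank_one_def cinner_scaleC_left e)
    qed
    moreover have l': "l = of_real (Re l)" using l by simp
    ultimately have "(Re l)\<^sup>2 = c\<^sup>2"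
      by (metis of_real_eq_iff of_real_mult power2_eq_square)
    hence "Re l = \<bar>c\<bar>" using l(2) by (metis abs_of_nonneg real_sqrt_abs)
    hence leq: "l = of_real \<bar>c\<bar>" using l' by metis
    show "B = rank_one e (complex_of_real \<bar>c\<bar>)"
    proof
      fix z
      have "B z = B ((z - cinner z e *\<^sub>C e) + cinner z e *\<^sub>C e)" by simp
      also have "\<dots> = cinner z e *\<^sub>C (l *\<^sub>C e)"
        unfolding add using ker[OF proj] by (simp add: sc Be)
      finally show "B z = rank_one e (complex_of_real \<bar>c\<bar>) z"
        by (simp add: rank_one_def scaleC_scaleC leq mult.commute)
    qed
  qed
  finally show ?thesis .
qed

section \<open>Trace and Hilbert--Schmidt norms of rank-one operators along a basis vector\<close>

context
  fixes E :: "'h::complex_hilbert set" and e :: 'h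
  assumes E: "complete_orthonormal_system E" and e: "e \<in> E"
begin

lemma cinner_cons: "f \<in> E \<Longrightarrow> cinner f e = (if f = e then 1 else 0)"
  using E e by (auto simp: complete_orthonormal_system_def)

lemma cinner_cons_self: "cinner e e = 1"
  using cinner_cons e by simp

lemma norm_cons: "norm e = 1"
  by (rule norm_eq_1_if_cinner[OF cinner_cons_self])

lemma trace_norm_rank_one_real: "trace_norm E (rank_one e (complex_of_real c)) = ennreal \<bar>c\<bar>"
proof -
  have "trace_norm E (rank_one e (complex_of_real c)) = (\<Sum>\<^sub>\<infinity>f\<in>{e}. ennreal \<bar>c\<bar>)"
    unfolding trace_norm_def op_abs_rank_one_real[OF cinner_cons_self] using e
    by (intro infsum_cong_neutral)
       (auto simp: rank_one_def cinner_scaleC_left cinner_cons cinner_cons_self)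
  thus ?thesis by simp
qed

lemma norm_rank_one_cons: "f \<in> E \<Longrightarrow> (norm (rank_one e c f))\<^sup>2 = (if f = e then (cmod c)\<^sup>2 else 0)"
  by (simp add: rank_one_def norm_scaleC norm_cons cinner_cons)

lemma hs_operators_rank_one: "rank_one e c \<in> hs_operators E"
proof -
  have "(\<lambda>f. (norm (rank_one e c f))\<^sup>2) summable_on E \<longleftrightarrow> (\<lambda>f. (cmod c)\<^sup>2) summable_on {e}"
    using e by (intro summable_on_cong_neutral) (auto simp: norm_rank_one_cons)
  thus ?thesis
    using bounded_clinear_rank_one[OF cinner_cons_self] by (simp add: hs_operators_def)
qed

lemma hs_norm_rank_one: "hs_norm E (rank_one e c) = cmod c"
proof -
  have "(\<Sum>\<^sub>\<infinity>f\<in>E. (norm (rank_one e c f))\<^sup>2) = (\<Sum>\<^sub>\<infinity>f\<in>{e}. (cmod c)\<^sup>2)"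
    using e by (intro infsum_cong_neutral) (auto simp: norm_rank_one_cons)
  thus ?thesis by (simp add: hs_norm_def)
qed

lemma hs_dist_rank_one: "hs_dist E (rank_one e a) (rank_one e b) = cmod (a - b)"
proof -
  have "(\<lambda>z. rank_one e a z - rank_one e b z) = rank_one e (a - b)"
    by (simp add: rank_one_def fun_eq_iff scaleC_diff_left left_diff_distrib)
  thus ?thesis by (simp add: hs_dist_def hs_norm_rank_one)
qed

end

lemma complete_orthonormal_system_nonempty:
  fixes E :: "'h::complex_hilbert set"
  assumes "complete_orthonormal_system E" "(UNIV :: 'h set) \<noteq> {0}"
  shows "E \<noteq> {}"
proof
  assume "E = {}"
  hence "{\<Sum>e\<in>F. c e *\<^sub>C e | F c. finite F \<and> F \<subseteq> E} = {0::'h}" by auto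
  thus False using assms by (simp add: complete_orthonormal_system_def)
qed

text \<open>The set is the complement of an open ball, and open sets generate
  \<open>hs_borel\<close>. This makes the failure of an estimator a measurable event.\<close>

lemma sets_hs_dist_ge:
  assumes E: "complete_orthonormal_system E" and B: "B \<in> hs_operators E"
  shows "{A \<in> hs_operators E. hs_dist E A B \<ge> r} \<in> sets (hs_borel E)"
    and "space (hs_borel E) = hs_operators E"
proof -
  interpret M: Metric_space "hs_operators E" "hs_dist E" by (rule Metric_space_hs[OF E])
  have sub: "{U. openin M.mtopology U} \<subseteq> Pow (hs_operators E)"
    using openin_subset M.topspace_mtopology by fastforce
  show sp: "space (hs_borel E) = hs_operators E"
    using sub by (simp add: hs_borel_def space_measure_of)
  have "M.mball B r \<in> sets (hs_borel E)"
    using sub by (auto simp: hs_borel_def sets_measure_of)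
  hence "space (hs_borel E) - M.mball B r \<in> sets (hs_borel E)" by auto
  also have "space (hs_borel E) - M.mball B r = {A \<in> hs_operators E. hs_dist E A B \<ge> r}"
    using B unfolding sp by (auto simp: M.mball_def M.commute)
  finally show "{A \<in> hs_operators E. hs_dist E A B \<ge> r} \<in> sets (hs_borel E)" .
qed

section \<open>Linear Gaussian fields\<close>

lemma cmod_cinner_le:
  fixes x y :: "'h::complex_hilbert"
  shows "cmod (cinner x y) \<le> norm x * norm y"
proof (cases "y = 0")
  case False
  define c where "c = complex_of_real (1 / norm y)"
  have "cinner (c *\<^sub>C y) (c *\<^sub>C y) = 1"
    using False by (simp add: cinner_self norm_scaleC c_def norm_divide)
  hence "cmod (cinner x (c *\<^sub>C y)) \<le> norm x" by (rule cmod_cinner_unit_le)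
  thus ?thesis using False by (simp add: cinner_scaleC_right c_def norm_divide norm_mult field_simps)
qed simp

lemma bounded_bilinear_cinner: "bounded_bilinear (cinner :: 'h::complex_hilbert \<Rightarrow> 'h \<Rightarrow> complex)"
proof
  show "cinner (x + y) z = cinner x z + cinner y z" for x y z :: 'h by (rule cinner_add_left)
  show "cinner x (y + z) = cinner x y + cinner x z" for x y z :: 'h by (rule cinner_add_right)
  show "cinner (r *\<^sub>R x) y = r *\<^sub>R cinner x y" for r and x y :: 'h
    by (simp add: cinner_scaleR_left scaleR_conv_of_real)
  show "cinner x (r *\<^sub>R y) = r *\<^sub>R cinner x y" for r and x y :: 'h
    by (simp add: scaleR_scaleC[of r y] cinner_scaleC_right scaleR_conv_of_real)
  show "\<exists>K. \<forall>x y::'h. cmod (cinner x y) \<le> norm x * norm y * K"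
    by (intro exI[of _ 1]) (simp add: cmod_cinner_le)
qed

lemma bounded_bilinear_scaleC: "bounded_bilinear (scaleC :: complex \<Rightarrow> 'h::complex_hilbert \<Rightarrow> 'h)"
proof
  show "(a + b) *\<^sub>C x = a *\<^sub>C x + b *\<^sub>C x" for a b and x :: 'h by (rule scaleC_add_left)
  show "a *\<^sub>C (x + y) = a *\<^sub>C x + a *\<^sub>C y" for a and x y :: 'h by (rule scaleC_add_right)
  show "(r *\<^sub>R a) *\<^sub>C x = r *\<^sub>R (a *\<^sub>C x)" for r a and x :: 'h
    by (simp add: scaleR_scaleC[of r "a *\<^sub>C x"] scaleC_scaleC scaleR_conv_of_real)
  show "a *\<^sub>C (r *\<^sub>R x) = r *\<^sub>R (a *\<^sub>C x)" for r a and x :: 'h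
    by (simp add: scaleR_scaleC scaleC_scaleC mult.commute)
  show "\<exists>K. \<forall>a (x::'h). norm (a *\<^sub>C x) \<le> norm a * norm x * K"
    by (intro exI[of _ 1]) (simp add: norm_scaleC)
qed

lemma borel_measurable_cinner [measurable (raw)]:
  fixes f g :: "'a \<Rightarrow> 'h::{complex_hilbert, second_countable_topology}"
  assumes "f \<in> borel_measurable M" "g \<in> borel_measurable M"
  shows "(\<lambda>x. cinner (f x) (g x)) \<in> borel_measurable M"
  using assms
  by (rule borel_measurable_continuous_Pair)
     (intro bounded_bilinear.continuous_on[OF bounded_bilinear_cinner] continuous_intros)

lemma borel_measurable_scaleC [measurable (raw)]:
  fixes g :: "'a \<Rightarrow> 'h::{complex_hilbert, second_countable_topology}"
  assumes "f \<in> borel_measurable M" "g \<in> borel_measurable M"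
  shows "(\<lambda>x. f x *\<^sub>C g x) \<in> borel_measurable M"
  using assms
  by (rule borel_measurable_continuous_Pair)
     (intro bounded_bilinear.continuous_on[OF bounded_bilinear_scaleC] continuous_intros)

section \<open>Moments, independence and linear images of the coordinates of Gaussian noise\<close>

lemma has_bochner_integral_std_normal:
  "has_bochner_integral std_normal (\<lambda>x. x) 0"
  "has_bochner_integral std_normal (\<lambda>x. x\<^sup>2) 1"
  unfolding std_normal_def
  using std_normal_moment_odd[of 0] std_normal_moment_even[of 1]
  by (auto intro!: has_bochner_integral_density)

lemma has_bochner_integral_gauss_component:
  assumes "has_bochner_integral std_normal f c" "i \<in> I"
  shows "has_bochner_integral (gauss I) (\<lambda>\<omega>. f (\<omega> i)) (c :: real)"
proof -
  have [measurable]: "f \<in> borel_measurable std_normal" "(\<lambda>\<omega>. \<omega> i) \<in> gauss I \<rightarrow>\<^sub>M std_normal"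
    using assms by (auto dest: borel_measurable_has_bochner_integral)
  have "has_bochner_integral (distr (gauss I) std_normal (\<lambda>\<omega>. \<omega> i)) f c"
    using assms gauss.PiM_component[OF assms(2)] by simp
  thus ?thesis
    by (simp add: has_bochner_integral_iff integrable_distr_eq integral_distr)
qed

text \<open>Independence amounts to the joint law being the product of the marginals, and
  restricting a product measure to finitely many coordinates gives such a product.\<close>

lemma indep_vars_gauss:
  fixes J :: "'i set"
  assumes "finite J"
  shows "prob_space.indep_vars (gauss (UNIV :: 'i set)) (\<lambda>_. borel) (\<lambda>i \<omega>. \<omega> i) J"
proof (cases "J = {}")
  case True
  thus ?thesis by (simp add: gauss.P.indep_vars_def gauss.P.indep_sets_def)
next
  case False
  have b: "distr (gauss UNIV) borel (\<lambda>\<omega>. \<omega> i) = std_normal" for i :: 'i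
    using gauss.PiM_component[of i UNIV] by (simp cong: distr_cong)
  have "distr (gauss UNIV) (\<Pi>\<^sub>M i\<in>J. borel) (\<lambda>\<omega>. \<lambda>i\<in>J. \<omega> i) = distr (gauss UNIV) (gauss J) (\<lambda>\<omega>. restrict \<omega> J)"
    by (intro distr_cong sets_PiM_cong) auto
  also have "\<dots> = gauss J" using assms by (rule gauss.distr_PiM_restrict_finite) simp
  finally show ?thesis
    using False by (subst gauss.P.indep_vars_iff_distr_eq_PiM') (auto simp: b)
qed

lemma has_bochner_integral_gauss_mult:
  fixes i j :: 'i
  shows "has_bochner_integral (gauss (UNIV :: 'i set)) (\<lambda>\<omega>. \<omega> i * \<omega> j) (if i = j then 1 else 0)"
proof (cases "i = j")
  case True
  thus ?thesis
    using has_bochner_integral_gauss_component[OF has_bochner_integral_std_normal(2), of i UNIV]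
    by (simp add: power2_eq_square)
next
  case False
  note * = has_bochner_integral_gauss_component[OF has_bochner_integral_std_normal(1), of _ "UNIV :: 'i set", simplified]
  have ind: "prob_space.indep_vars (gauss (UNIV :: 'i set)) (\<lambda>_. borel) (\<lambda>i \<omega>. \<omega> i) {i, j}"
    by (rule indep_vars_gauss) simp
  show ?thesis
    using gauss.P.indep_vars_lebesgue_integral[OF _ ind] gauss.P.indep_vars_integrable[OF _ ind] * False
    by (simp add: has_bochner_integral_iff)
qed

lemma real_normal_law_gauss_linear:
  fixes a :: "'i \<Rightarrow> real"
  assumes "finite S"
  shows "real_normal_law (distr (gauss UNIV) borel (\<lambda>\<omega>. \<Sum>l\<in>S. a l * \<omega> l))"
proof -
  \<comment> \<open>Zero coefficients are dropped because each remaining summand must have a normal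
    density; if nothing is left the law is the point mass at 0.\<close>
  define T where "T = {l\<in>S. a l \<noteq> 0}"
  have T: "finite T" using assms by (simp add: T_def)
  have eq: "(\<Sum>l\<in>S. a l * \<omega> l) = (\<Sum>l\<in>T. a l * \<omega> l)" for \<omega> :: "'i \<Rightarrow> real"
    using assms by (intro sum.mono_neutral_right) (auto simp: T_def)
  show ?thesis
  proof (cases "T = {}")
    case True
    have "distr (gauss (UNIV :: 'i set)) borel (\<lambda>\<omega>. 0 :: real) = return borel 0"
      by (rule gauss.P.distr_const) simp
    thus ?thesis unfolding eq True by (auto simp: real_normal_law_def)
  next
    case False
    have "distributed (gauss UNIV) lborel (\<lambda>\<omega>. \<omega> l) std_normal_density" for l :: 'i
      using gauss.PiM_component[of l UNIV]
      by (auto simp: distributed_def std_normal_def cong: distr_cong)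
    hence "distributed (gauss UNIV) lborel (\<lambda>\<omega>. 0 + a l * \<omega> l) (normal_density (0 + a l * 0) (\<bar>a l\<bar> * 1))"
      if "l \<in> T" for l
      using that by (intro gauss.P.normal_density_affine) (auto simp: T_def)
    hence "distributed (gauss UNIV) lborel (\<lambda>\<omega>. a l * \<omega> l) (normal_density 0 \<bar>a l\<bar>)" if "l \<in> T" for l
      using that by simp
    moreover have "prob_space.indep_vars (gauss UNIV) (\<lambda>_. borel) (\<lambda>l \<omega>. a l * \<omega> l) T"
      by (rule gauss.P.indep_vars_compose2[OF indep_vars_gauss[OF T]]) simp
    ultimately have "distributed (gauss UNIV) lborel (\<lambda>\<omega>. \<Sum>l\<in>T. a l * \<omega> l)
       (normal_density (\<Sum>l\<in>T. 0) (sqrt (\<Sum>l\<in>T. \<bar>a l\<bar>\<^sup>2)))"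
      using T False by (intro gauss.P.sum_indep_normal) (auto simp: T_def)
    hence "distr (gauss UNIV) borel (\<lambda>\<omega>. \<Sum>l\<in>T. a l * \<omega> l) =
       density lborel (normal_density 0 (sqrt (\<Sum>l\<in>T. (a l)\<^sup>2)))"
      by (simp add: distributed_def cong: distr_cong)
    moreover have "sqrt (\<Sum>l\<in>T. (a l)\<^sup>2) > 0"
      using T False by (auto simp: T_def intro!: sum_pos)
    ultimately show ?thesis unfolding eq real_normal_law_def by blast
  qed
qed

text \<open>Summing over the support of \<open>a t\<close> ties the field to no particular finite
  index set, so one noise space serves all points \<open>t\<close>.\<close>

definition linear_field :: "('t \<Rightarrow> 'i \<Rightarrow> real) \<Rightarrow> 't \<Rightarrow> ('i \<Rightarrow> real) \<Rightarrow> real" where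
  "linear_field a t \<omega> = (\<Sum>l | a t l \<noteq> 0. a t l * \<omega> l)"

text \<open>The field is pushed forward to the path space because the classes of densities and of
  Gaussian laws are stated for coordinate processes.\<close>

definition linear_field_law ::
  "'h::complex_hilbert \<Rightarrow> (int ^ 'd \<Rightarrow> 'i \<Rightarrow> real) \<Rightarrow> (int ^ 'd \<Rightarrow> 'h) measure" where
  "linear_field_law e a = distr (gauss UNIV) path_space (\<lambda>\<omega> t. linear_field a t \<omega> *\<^sub>R e)"

lemma linear_field_eq_sum:
  assumes "finite S" "\<And>l. a t l \<noteq> 0 \<Longrightarrow> l \<in> S"
  shows "linear_field a t \<omega> = (\<Sum>l\<in>S. a t l * \<omega> l)"
  unfolding linear_field_def using assms by (intro sum.mono_neutral_left) auto

context
  fixes a :: "'t \<Rightarrow> 'i \<Rightarrow> real"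
  assumes fin: "finite {l. a t l \<noteq> 0}"
begin

lemma measurable_linear_field [measurable]: "linear_field a t \<in> borel_measurable (gauss UNIV)"
  unfolding linear_field_def by measurable

lemma has_bochner_integral_linear_field: "has_bochner_integral (gauss UNIV) (linear_field a t) 0"
proof -
  have "has_bochner_integral (gauss UNIV) (\<lambda>\<omega>. \<Sum>l | a t l \<noteq> 0. a t l * \<omega> l) (\<Sum>l | a t l \<noteq> 0. a t l * 0)"
    using has_bochner_integral_gauss_component[OF has_bochner_integral_std_normal(1), of _ "UNIV :: 'i set"]
    by (intro has_bochner_integral_sum has_bochner_integral_mult_right) auto
  thus ?thesis by (simp add: linear_field_def[abs_def])
qed

end

text \<open>Both fields are expanded over the union of their supports; orthonormality of the noise
  leaves the diagonal.\<close>

lemma has_bochner_integral_linear_field_mult: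
  fixes a :: "'t \<Rightarrow> 'i \<Rightarrow> real"
  assumes fin: "\<And>t. finite {l. a t l \<noteq> 0}"
  shows "has_bochner_integral (gauss UNIV) (\<lambda>\<omega>. linear_field a s \<omega> * linear_field a t \<omega>)
           (\<Sum>l | a s l \<noteq> 0. a s l * a t l)"
proof -
  define S where "S = {l. a s l \<noteq> 0} \<union> {l. a t l \<noteq> 0}"
  have S: "finite S" using fin by (simp add: S_def)
  have "(\<Sum>k\<in>S. \<Sum>l\<in>S. (a s k * a t l) * (if k = l then 1 else 0)) = (\<Sum>l\<in>S. a s l * a t l)"
    using S by (simp add: if_distrib cong: if_cong)
  also have "\<dots> = (\<Sum>l | a s l \<noteq> 0. a s l * a t l)"
    using S by (intro sum.mono_neutral_right) (auto simp: S_def)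
  finally have c: "(\<Sum>k\<in>S. \<Sum>l\<in>S. (a s k * a t l) * (if k = l then 1 else 0)) = \<dots>" .
  have "linear_field a s \<omega> * linear_field a t \<omega> = (\<Sum>k\<in>S. \<Sum>l\<in>S. (a s k * a t l) * (\<omega> k * \<omega> l))" for \<omega>
    using S by (subst (1 2) linear_field_eq_sum[where S = S]) (auto simp: S_def sum_product mult_ac)
  moreover have "has_bochner_integral (gauss UNIV) (\<lambda>\<omega>. \<Sum>k\<in>S. \<Sum>l\<in>S. (a s k * a t l) * (\<omega> k * \<omega> l))
     (\<Sum>k\<in>S. \<Sum>l\<in>S. (a s k * a t l) * (if k = l then 1 else 0))"
    by (intro has_bochner_integral_sum has_bochner_integral_mult_right has_bochner_integral_gauss_mult)
  ultimately show ?thesis by (simp add: c)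
qed

section \<open>Laws of stationary linear fields in one real direction; stationarity is the
  assumption \<open>cov\<close>\<close>

context
  fixes E :: "'h::{complex_hilbert, second_countable_topology} set" and e :: 'h
    and a :: "int ^ 'd \<Rightarrow> 'i \<Rightarrow> real" and c :: "int ^ 'd \<Rightarrow> real"
  assumes E: "complete_orthonormal_system E" and e: "e \<in> E"
    and fin: "\<And>t. finite {l. a t l \<noteq> 0}"
    and cov: "\<And>t k. (\<Sum>l | a (t + k) l \<noteq> 0. a (t + k) l * a t l) = c k"
begin

lemma measurable_linear_field_path [measurable]:
  "(\<lambda>\<omega> t. linear_field a t \<omega> *\<^sub>R e) \<in> gauss UNIV \<rightarrow>\<^sub>M path_space"
  unfolding path_space_def
  by (rule measurable_PiM_single') (auto intro!: borel_measurable_scaleR measurable_linear_field fin)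

lemma measurable_path_component [measurable]:
  "(\<lambda>\<omega>. \<omega> t) \<in> borel_measurable (path_space :: (int ^ 'd \<Rightarrow> 'h) measure)"
  unfolding path_space_def by measurable

lemma measurable_coord [measurable]: "coord t \<in> borel_measurable (path_space :: (int ^ 'd \<Rightarrow> 'h) measure)"
  unfolding coord_def[abs_def] by measurable

lemma sets_linear_field_law [measurable_cong]: "sets (linear_field_law e a) = sets path_space"
  by (simp add: linear_field_law_def)

lemma integral_linear_field_law:
  fixes g :: "(int ^ 'd \<Rightarrow> 'h) \<Rightarrow> 'b::{banach, second_countable_topology}"
  assumes "g \<in> borel_measurable path_space"
    and "has_bochner_integral (gauss UNIV) (\<lambda>\<omega>. g (\<lambda>t. linear_field a t \<omega> *\<^sub>R e)) I"
  shows "has_bochner_integral (linear_field_law e a) g I"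
  unfolding linear_field_law_def
  using assms measurable_linear_field_path
  by (simp add: has_bochner_integral_iff integrable_distr_eq integral_distr)

lemma cross_cov_linear_field_law:
  "cross_cov (linear_field_law e a) (coord (t + k)) (coord t) = rank_one e (of_real (c k))"
proof
  fix z
  have "(linear_field a t \<omega> *\<^sub>R e) = complex_of_real (linear_field a t \<omega>) *\<^sub>C e" for t \<omega>
    by (rule scaleR_scaleC)
  hence *: "cinner z (linear_field a t \<omega> *\<^sub>R e) *\<^sub>C (linear_field a (t + k) \<omega> *\<^sub>R e)
    = (linear_field a (t + k) \<omega> * linear_field a t \<omega>) *\<^sub>R (cinner z e *\<^sub>C e)" for \<omega>
    by (simp add: cinner_scaleC_right scaleC_scaleC scaleR_scaleC mult_ac)
  have "has_bochner_integral (linear_field_law e a) (\<lambda>\<omega>. (coord (t + k) \<omega> \<otimes>\<^sub>H coord t \<omega>) z) 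
          (c k *\<^sub>R (cinner z e *\<^sub>C e))"
  proof (rule integral_linear_field_law)
    show "has_bochner_integral (gauss UNIV)
     (\<lambda>\<omega>. (coord (t + k) (\<lambda>t. linear_field a t \<omega> *\<^sub>R e) \<otimes>\<^sub>H coord t (\<lambda>t. linear_field a t \<omega> *\<^sub>R e)) z)
     (c k *\<^sub>R cinner z e *\<^sub>C e)"
      unfolding coord_def tensor_def * cov[of t k, symmetric]
      using has_bochner_integral_linear_field_mult[of a, OF fin] 
      by (intro has_bochner_integral_scaleR_left) 
  qed (simp add: tensor_def)
  thus "cross_cov (linear_field_law e a) (coord (t + k)) (coord t) z = rank_one e (of_real (c k)) z"
    by (simp add: cross_cov_def has_bochner_integral_iff rank_one_def scaleR_scaleC scaleC_scaleC)
qed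

lemma real_stationary_process_linear_field_law:
  "real_stationary_process E (linear_field_law e a) coord"
proof -
  have m: "coord t \<in> borel_measurable (linear_field_law e a)" for t
    using measurable_coord by measurable
  have norm: "norm e = 1" and ee: "cinner e e = 1" 
    by (rule norm_cons[OF E e], rule cinner_cons_self[OF E e])
  have "integrable (linear_field_law e a) (\<lambda>\<omega>. (norm (coord t \<omega>))\<^sup>2)" for t
  proof -
    have "has_bochner_integral (linear_field_law e a) (\<lambda>\<omega>. (norm (coord t \<omega>))\<^sup>2) (\<Sum>l | a t l \<noteq> 0. a t l * a t l)"
      using has_bochner_integral_linear_field_mult[of a t t, OF fin]
      by (intro integral_linear_field_law) (auto simp: coord_def norm power2_eq_square)
    thus ?thesis by (simp add: has_bochner_integral_iff)
  qed
  moreover have "(\<integral>\<omega>. coord t \<omega> \<partial>linear_field_law e a) = 0" for t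
  proof -
    have "has_bochner_integral (linear_field_law e a) (coord t) (0 *\<^sub>R e)"
    proof (intro integral_linear_field_law measurable_coord)
      show "has_bochner_integral (gauss UNIV) (\<lambda>\<omega>. coord t (\<lambda>t. linear_field a t \<omega> *\<^sub>R e)) (0 *\<^sub>R e)"
        unfolding coord_def
        by (intro has_bochner_integral_scaleR_left has_bochner_integral_linear_field fin)
    qed
    thus ?thesis by (simp add: has_bochner_integral_iff)
  qed
  moreover have "AE \<omega> in linear_field_law e a. real_vec E (coord t \<omega>)" for t
  proof -
    \<comment> \<open>A measurable way to say that the value is a real multiple of \<open>e\<close>:
      it passes through the image measure and implies that all coefficients are real.\<close>
    have "AE \<omega> in linear_field_law e a. coord t \<omega> = Re (cinner (coord t \<omega>) e) *\<^sub>R e"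
      unfolding linear_field_law_def
      by (subst AE_distr_iff) (auto simp: coord_def cinner_scaleR_left ee)
    thus ?thesis
    proof eventually_elim
      case (elim \<omega>)
      show ?case
        unfolding real_vec_def
      proof
        fix f assume f: "f \<in> E"
        have "cinner e f \<in> \<real>"
          using E e f by (auto simp: complete_orthonormal_system_def)
        thus "cinner (coord t \<omega>) f \<in> \<real>" by (subst elim) (simp add: cinner_scaleR_left)
      qed
    qed
  qed
  moreover have "prob_space (linear_field_law e a)"
    unfolding linear_field_law_def by (intro gauss.P.prob_space_distr) measurable
  ultimately show ?thesis
    using m by (simp add: real_stationary_process_def cross_cov_linear_field_law)
qed

text \<open>A real functional of finitely many values is again a finite linear combination of the
  noise, over the union \<open>S\<close> of the supports.\<close>

lemma gaussian_process_linear_field_law: "gaussian_process (linear_field_law e a) coord"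
  unfolding gaussian_process_def
proof (intro allI impI)
  fix T :: "(int ^ 'd) set" and h :: "int ^ 'd \<Rightarrow> 'h"
  assume T: "finite T"
  define S where "S = (\<Union>t\<in>T. {l. a t l \<noteq> 0})"
  have S: "finite S" using T fin by (auto simp: S_def)
  have "(\<Sum>t\<in>T. Re (cinner (linear_field a t \<omega> *\<^sub>R e) (h t))) =
     (\<Sum>l\<in>S. (\<Sum>t\<in>T. a t l * Re (cinner e (h t))) * \<omega> l)" for \<omega>
  proof -
    have "(\<Sum>t\<in>T. Re (cinner (linear_field a t \<omega> *\<^sub>R e) (h t))) =
       (\<Sum>t\<in>T. (\<Sum>l\<in>S. a t l * \<omega> l) * Re (cinner e (h t)))"
    proof (intro sum.cong refl)
      fix t assume "t \<in> T"
      hence "linear_field a t \<omega> = (\<Sum>l\<in>S. a t l * \<omega> l)"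
        using S by (intro linear_field_eq_sum) (auto simp: S_def)
      thus "Re (cinner (linear_field a t \<omega> *\<^sub>R e) (h t)) = (\<Sum>l\<in>S. a t l * \<omega> l) * Re (cinner e (h t))"
        by (simp add: cinner_scaleR_left)
    qed
    also have "\<dots> = (\<Sum>l\<in>S. \<Sum>t\<in>T. a t l * \<omega> l * Re (cinner e (h t)))"
      by (subst sum.swap) (simp add: sum_distrib_right)
    finally show ?thesis by (simp add: sum_distrib_left sum_distrib_right mult_ac)
  qed
  note eq = this
  have m: "(\<lambda>\<omega>. \<Sum>t\<in>T. Re (cinner (coord t \<omega>) (h t))) \<in> borel_measurable path_space"
    by measurable
  have "distr (linear_field_law e a) borel (\<lambda>\<omega>. \<Sum>t\<in>T. Re (cinner (coord t \<omega>) (h t))) =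
     distr (gauss UNIV) borel (\<lambda>\<omega>. \<Sum>l\<in>S. (\<Sum>t\<in>T. a t l * Re (cinner e (h t))) * \<omega> l)"
    unfolding linear_field_law_def distr_distr[OF m measurable_linear_field_path]
    by (simp only: comp_def coord_def eq)
  thus "real_normal_law (distr (linear_field_law e a) borel (\<lambda>\<omega>. \<Sum>t\<in>T. Re (cinner (coord t \<omega>) (h t))))"
    by (simp only: real_normal_law_gauss_linear[OF S])
qed

lemma autocov_linear_field_law: "autocov (linear_field_law e a) coord k = rank_one e (of_real (c k))"
  unfolding autocov_def by (rule cross_cov_linear_field_law)

lemma trace_norm_autocov_linear_field_law:
  "trace_norm E (autocov (linear_field_law e a) coord k) = ennreal \<bar>c k\<bar>"
  by (simp add: autocov_linear_field_law trace_norm_rank_one_real[OF E e])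

end

section \<open>Modulated bumps\<close>

lemma real_of_int_vec_diff: "real_of_int_vec (s - t) = real_of_int_vec s - real_of_int_vec t"
  by (simp add: real_of_int_vec_def vec_eq_iff)

lemma real_of_int_vec_zero [simp]: "real_of_int_vec 0 = 0"
  by (simp add: real_of_int_vec_def vec_eq_iff)

lemma card_obs_cube: "card (obs_cube n :: (int ^ 'd) set) = n ^ CARD('d)"
  and finite_obs_cube: "finite (obs_cube n :: (int ^ 'd) set)"
proof -
  have bij: "bij_betw vec_nth (obs_cube n :: (int ^ 'd) set) (\<Pi>\<^sub>E i\<in>UNIV. {1..int n})"
    by (rule bij_betwI[where g = vec_lambda]) (auto simp: obs_cube_def)
  show "card (obs_cube n :: (int ^ 'd) set) = n ^ CARD('d)"
    using bij_betw_same_card[OF bij] by (simp add: card_PiE)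
  show "finite (obs_cube n :: (int ^ 'd) set)"
    using bij_betw_finite[OF bij] by (simp add: finite_PiE)
qed

lemma norm_obs_cube_diff_le:
  fixes v w :: "int ^ 'd"
  assumes "v \<in> obs_cube m" "w \<in> obs_cube m"
  shows "norm (real_of_int_vec (v - w)) \<le> real CARD('d) * real m"
proof -
  have "norm (real_of_int_vec (v - w)) \<le> (\<Sum>i\<in>UNIV. \<bar>real_of_int_vec (v - w) $ i\<bar>)"
    by (rule norm_le_l1_cart)
  also have "\<dots> \<le> (\<Sum>i\<in>(UNIV :: 'd set). real m)"
  proof (rule sum_mono)
    fix i
    have "\<bar>v $ i - w $ i\<bar> \<le> int m"
      using assms by (auto simp: obs_cube_def dest!: spec[of _ i])
    thus "\<bar>real_of_int_vec (v - w) $ i\<bar> \<le> real m"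
      by (simp add: real_of_int_vec_def)
  qed
  finally show ?thesis by simp
qed

text \<open>The autocorrelation of the indicator function of \<open>B\<close> at lag
  \<open>k\<close>.\<close>

definition overlap :: "'a::ab_group_add set \<Rightarrow> 'a \<Rightarrow> real" where
  "overlap B k = real (card {v\<in>B. v - k \<in> B})"

definition diff_set :: "'a::ab_group_add set \<Rightarrow> 'a set" where
  "diff_set B = (\<lambda>(v, w). v - w) ` (B \<times> B)"

context
  fixes B :: "'a::ab_group_add set"
  assumes fin: "finite B"
begin

lemma finite_diff_set: "finite (diff_set B)"
  using fin by (simp add: diff_set_def)

lemma overlap_bounds: "0 \<le> overlap B k" "overlap B k \<le> card B"
  using fin by (auto simp: overlap_def intro!: card_mono)

lemma overlap_eq_0: "k \<notin> diff_set B \<Longrightarrow> overlap B k = 0"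
proof -
  assume k: "k \<notin> diff_set B"
  have "v - k \<notin> B" if "v \<in> B" for v
  proof
    assume "v - k \<in> B"
    with that have "v - (v - k) \<in> diff_set B" unfolding diff_set_def by blast
    with k show False by simp
  qed
  hence "{v\<in>B. v - k \<in> B} = {}" by auto
  thus ?thesis by (simp only: overlap_def card.empty of_nat_0)
qed

text \<open>Pairs of points of \<open>B\<close> are sorted by their difference.\<close>

lemma sum_overlap: "(\<Sum>k\<in>diff_set B. overlap B k * g k) = (\<Sum>v\<in>B. \<Sum>w\<in>B. g (v - w))"
proof -
  have "(\<Sum>k\<in>diff_set B. overlap B k * g k) = (\<Sum>k\<in>diff_set B. \<Sum>v\<in>B. if v - k \<in> B then g k else 0)"
    using fin by (simp add: overlap_def flip: sum.inter_filter)
  also have "\<dots> = (\<Sum>v\<in>B. \<Sum>k\<in>diff_set B. if v - k \<in> B then g k else 0)" by (rule sum.swap)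
  also have "\<dots> = (\<Sum>v\<in>B. \<Sum>k\<in>{k\<in>diff_set B. v - k \<in> B}. g k)"
    using finite_diff_set by (simp add: sum.inter_filter)
  also have "\<dots> = (\<Sum>v\<in>B. \<Sum>w\<in>B. g (v - w))"
    by (intro sum.cong refl sum.reindex_bij_witness[of _ "\<lambda>w. _ - w" "\<lambda>k. _ - k"])
       (auto simp: diff_set_def)
  finally show ?thesis .
qed

text \<open>For fixed \<open>s\<close> the lags are distinct. One factor of the square is at most
  \<open>card B\<close>, and the other sums to at most the number of pairs.\<close>

lemma sum_overlap_sq_le:
  assumes "finite T"
  shows "(\<Sum>t\<in>T. (overlap B (s - t))\<^sup>2) \<le> real (card B) ^ 3"
proof -
  have "(\<Sum>t\<in>T. (overlap B (s - t))\<^sup>2) = (\<Sum>k\<in>(\<lambda>t. s - t) ` T. (overlap B k)\<^sup>2)"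
    by (subst sum.reindex) (auto simp: inj_on_def)
  also have "\<dots> = (\<Sum>k\<in>(\<lambda>t. s - t) ` T \<inter> diff_set B. (overlap B k)\<^sup>2)"
    using assms overlap_eq_0 by (intro sum.mono_neutral_right) auto
  also have "\<dots> \<le> (\<Sum>k\<in>diff_set B. (overlap B k)\<^sup>2)"
    by (intro sum_mono2 finite_diff_set) auto
  also have "\<dots> \<le> (\<Sum>k\<in>diff_set B. overlap B k * card B)"
    unfolding power2_eq_square by (intro sum_mono mult_left_mono overlap_bounds)
  also have "\<dots> = real (card B) ^ 3"
    unfolding sum_overlap by (simp add: power3_eq_cube)
  finally show ?thesis .
qed

end

section \<open>Modulated moving averages and their covariance\<close>

definition phase :: "real ^ 'd \<Rightarrow> int ^ 'd \<Rightarrow> real" where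
  "phase \<theta> k = real_of_int_vec k \<bullet> \<theta>"

lemma phase_diff: "phase \<theta> (s - t) = phase \<theta> s - phase \<theta> t"
  by (simp add: phase_def real_of_int_vec_diff inner_diff_left)

lemma phase_zero [simp]: "phase \<theta> 0 = 0"
  by (simp add: phase_def)

text \<open>
  Doubling the angle turns the sum into half of \<open>card B ^ 2\<close> plus half of a sum of two squares.
\<close>

lemma sum_overlap_cos_sq_ge:
  fixes B :: "(int ^ 'd) set"
  assumes "finite B"
  shows "(\<Sum>k\<in>diff_set B. overlap B k * (cos (phase \<theta> k))\<^sup>2) \<ge> (real (card B))\<^sup>2 / 2"
proof -
  have "(\<Sum>k\<in>diff_set B. overlap B k * (cos (phase \<theta> k))\<^sup>2) = 
     (\<Sum>v\<in>B. \<Sum>w\<in>B. 1 / 2 + cos (2 * phase \<theta> v - 2 * phase \<theta> w) / 2)"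
    unfolding sum_overlap[OF assms] phase_diff
  proof (intro sum.cong refl)
    fix v w
    show "(cos (phase \<theta> v - phase \<theta> w))\<^sup>2 = 1 / 2 + cos (2 * phase \<theta> v - 2 * phase \<theta> w) / 2"
      using cos_double_cos[of "phase \<theta> v - phase \<theta> w"] by (simp add: algebra_simps)
  qed
  also have "\<dots> = (\<Sum>v\<in>B. \<Sum>w\<in>B. 1 / 2) + ((\<Sum>v\<in>B. cos (2 * phase \<theta> v))\<^sup>2 + (\<Sum>v\<in>B. sin (2 * phase \<theta> v))\<^sup>2) / 2"
    unfolding power2_eq_square sum_product
    by (simp add: cos_diff sum.distrib sum_divide_distrib add_divide_distrib)
  also have "\<dots> \<ge> (\<Sum>v\<in>B. \<Sum>w\<in>B. 1 / 2)" by simp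
  finally show ?thesis by (simp add: power2_eq_square)
qed

text \<open>The weight with which noise at site \<open>u\<close> enters a layer at \<open>t\<close>;
  \<open>\<sigma>\<close> selects one of two independent moving averages.\<close>

definition bump :: "real ^ 'd \<Rightarrow> real \<Rightarrow> nat \<Rightarrow> int ^ 'd \<Rightarrow> int ^ 'd \<Rightarrow> bool \<Rightarrow> real" where
  "bump \<theta> b m t u \<sigma> =
     (if u - t \<in> obs_cube m then b * (if \<sigma> then cos (phase \<theta> t) else sin (phase \<theta> t)) else 0)"

text \<open>The cosine and sine parts combine by the addition theorem into a function of
  \<open>s - t\<close>, and the noise sites common to both points are counted by
  \<open>overlap\<close>. It is enough that \<open>U\<close> contains the sites used by
  \<open>t\<close>.\<close>

lemma bump_gram:
  fixes s t :: "int ^ 'd"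
  assumes U: "finite U" "(\<lambda>v. t + v) ` obs_cube m \<subseteq> U"
  shows "(\<Sum>u\<in>U. \<Sum>\<sigma>\<in>UNIV. bump \<theta> b m s u \<sigma> * bump \<theta> b m t u \<sigma>) =
           b\<^sup>2 * overlap (obs_cube m) (s - t) * cos (phase \<theta> (s - t))"
proof -
  let ?c = "b\<^sup>2 * cos (phase \<theta> (s - t))"
  have "(\<Sum>\<sigma>\<in>UNIV. bump \<theta> b m s u \<sigma> * bump \<theta> b m t u \<sigma>) =
      (if u - s \<in> obs_cube m \<and> u - t \<in> obs_cube m then ?c else 0)" for u
    by (auto simp: bump_def UNIV_bool phase_diff cos_diff power2_eq_square algebra_simps)
  hence "(\<Sum>u\<in>U. \<Sum>\<sigma>\<in>UNIV. bump \<theta> b m s u \<sigma> * bump \<theta> b m t u \<sigma>) =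
     real (card {u\<in>U. u - s \<in> obs_cube m \<and> u - t \<in> obs_cube m}) * ?c"
    using U by (simp flip: sum.inter_filter)
  also have "card {u\<in>U. u - s \<in> obs_cube m \<and> u - t \<in> obs_cube m} =
             card {v\<in>obs_cube m. v - (s - t) \<in> obs_cube m}"
    using U by (intro bij_betw_same_card[of "\<lambda>u. u - t"] bij_betwI[where g = "\<lambda>v. t + v"])
      (auto simp: algebra_simps)
  finally show ?thesis by (simp add: overlap_def)
qed

type_synonym 'd noise = "(int ^ 'd) + (int ^ 'd) \<times> nat \<times> bool"

text \<open>
  The first summand of the index type carries white noise. Each of the \<open>j\<close> layers indexed by the
  second carries two moving averages over a cube of side \<open>m\<close>, modulated by the cosine and the sine
  at frequency \<open>\<theta>\<close>, so that their sum is again stationary.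
\<close>

definition bump_field :: "real ^ 'd \<Rightarrow> real \<Rightarrow> real \<Rightarrow> nat \<Rightarrow> nat \<Rightarrow> int ^ 'd \<Rightarrow> 'd noise \<Rightarrow> real" where
  "bump_field \<theta> \<tau> b m j t l =
     (case l of Inl u \<Rightarrow> if u = t then \<tau> else 0
      | Inr (u, i, \<sigma>) \<Rightarrow> if i < j then \<tau> * bump \<theta> b m t u \<sigma> else 0)"

definition bump_cov :: "real ^ 'd \<Rightarrow> real \<Rightarrow> real \<Rightarrow> nat \<Rightarrow> nat \<Rightarrow> int ^ 'd \<Rightarrow> real" where
  "bump_cov \<theta> \<tau> b m j k =
     \<tau>\<^sup>2 * ((if k = 0 then 1 else 0) + real j * b\<^sup>2 * overlap (obs_cube m) k * cos (phase \<theta> k))"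

lemma bump_field_support:
  assumes "bump_field \<theta> \<tau> b m j t l \<noteq> 0" "(\<lambda>v. t + v) ` obs_cube m \<subseteq> U"
  shows "l \<in> insert (Inl t) (Inr ` (U \<times> {..<j} \<times> UNIV))"
proof (cases l)
  case (Inl u)
  thus ?thesis using assms by (auto simp: bump_field_def split: if_splits)
next
  case (Inr p)
  obtain u i \<sigma> where p: "p = (u, i, \<sigma>)" by (cases p)
  have "i < j" "u - t \<in> obs_cube m"
    using assms(1) by (auto simp: Inr p bump_field_def bump_def split: if_splits)
  moreover have "u = t + (u - t)" by simp
  ultimately show ?thesis using assms(2) unfolding Inr p by blast
qed

lemma finite_bump_field_support: "finite {l. bump_field \<theta> \<tau> b m j t l \<noteq> 0}"
proof (rule finite_subset)
  show "{l. bump_field \<theta> \<tau> b m j t l \<noteq> 0} \<subseteq>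
        insert (Inl t) (Inr ` (((\<lambda>v. t + v) ` obs_cube m) \<times> {..<j} \<times> UNIV))"
    using bump_field_support by blast
qed (auto simp: finite_obs_cube)

text \<open>The sum is moved to a set \<open>S\<close> that covers the support at \<open>t\<close>;
  outside it the second factor vanishes. Different layers use different noise, so each adds the same
  amount, whence the factor \<open>j\<close> in \<open>bump_cov\<close>.\<close>

lemma bump_field_cov:
  "(\<Sum>l | bump_field \<theta> \<tau> b m j (t + k) l \<noteq> 0. bump_field \<theta> \<tau> b m j (t + k) l * bump_field \<theta> \<tau> b m j t l) =
     bump_cov \<theta> \<tau> b m j k"
proof -
  let ?a = "bump_field \<theta> \<tau> b m j"
  define U where "U = (\<lambda>v. t + v) ` obs_cube m"
  have U: "finite U" by (simp add: U_def finite_obs_cube)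
  define S where "S = insert (Inl t) (Inr ` (U \<times> {..<j} \<times> (UNIV :: bool set)))"
  have "(\<Sum>l | ?a (t + k) l \<noteq> 0. ?a (t + k) l * ?a t l) = (\<Sum>l\<in>S. ?a (t + k) l * ?a t l)"
  proof (rule sum.mono_neutral_cong)
    show "?a (t + k) l * ?a t l = 0" if "l \<in> {l. ?a (t + k) l \<noteq> 0} - S" for l
      using that bump_field_support[of \<theta> \<tau> b m j t l U] by (auto simp: S_def U_def)
  qed (use U in \<open>auto simp: S_def finite_bump_field_support\<close>)
  also have "\<dots> = ?a (t + k) (Inl t) * ?a t (Inl t) +
     (\<Sum>p\<in>U \<times> {..<j} \<times> UNIV. ?a (t + k) (Inr p) * ?a t (Inr p))"
    unfolding S_def using U by (subst sum.insert) (auto simp: sum.reindex)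
  also have "(\<Sum>p\<in>U \<times> {..<j} \<times> UNIV. ?a (t + k) (Inr p) * ?a t (Inr p)) =
     (\<Sum>u\<in>U. \<Sum>i<j. \<Sum>\<sigma>\<in>UNIV. \<tau>\<^sup>2 * (bump \<theta> b m (t + k) u \<sigma> * bump \<theta> b m t u \<sigma>))"
    by (simp only: sum.cartesian_product, intro sum.cong refl)
       (auto simp: bump_field_def power2_eq_square mult_ac)
  also have "\<dots> = real j * \<tau>\<^sup>2 * (\<Sum>u\<in>U. \<Sum>\<sigma>\<in>UNIV. bump \<theta> b m (t + k) u \<sigma> * bump \<theta> b m t u \<sigma>)"
    by (simp add: sum_distrib_left mult_ac)
  also have "\<dots> = real j * \<tau>\<^sup>2 * (b\<^sup>2 * overlap (obs_cube m) k * cos (phase \<theta> k))"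
    using bump_gram[OF U, of t m \<theta> b "t + k"] by (simp add: U_def)
  also have "?a (t + k) (Inl t) * ?a t (Inl t) = \<tau>\<^sup>2 * (if k = 0 then 1 else 0)"
    by (auto simp: bump_field_def power2_eq_square)
  finally show ?thesis by (simp add: bump_cov_def algebra_simps)
qed

text \<open>White noise contributes at most \<open>\<tau>\<^sup>2\<close> at lag 0. For the layers,
  lags have length at most \<open>CARD('d) * m\<close>, which bounds the weight, and the overlaps
  sum to the squared volume of the cube, so hypothesis \<open>b\<close> gives another
  \<open>\<tau>\<^sup>2\<close>.\<close>

lemma sum_abs_bump_cov_le:
  fixes \<theta> :: "real ^ 'd"
  assumes m: "m \<ge> 1" and \<beta>: "\<beta> > 0"
    and b: "real j * b\<^sup>2 * (real m ^ CARD('d))\<^sup>2 * (1 + (real CARD('d) * real m) powr \<beta>) \<le> 1"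
  shows "(\<Sum>k\<in>diff_set (obs_cube m). \<bar>bump_cov \<theta> \<tau> b m j k\<bar> * (1 + norm (real_of_int_vec k) powr \<beta>)) \<le> 2 * \<tau>\<^sup>2"
proof -
  let ?B = "obs_cube m :: (int ^ 'd) set"
  let ?W = "1 + (real CARD('d) * real m) powr \<beta>"
  have B: "finite ?B" by (rule finite_obs_cube)
  have "\<bar>bump_cov \<theta> \<tau> b m j k\<bar> * (1 + norm (real_of_int_vec k) powr \<beta>) \<le>
     \<tau>\<^sup>2 * (if k = 0 then 1 else 0) + overlap ?B k * (\<tau>\<^sup>2 * real j * b\<^sup>2 * ?W)" if k: "k \<in> diff_set ?B" for k
  proof -
    let ?w = "1 + norm (real_of_int_vec k) powr \<beta>"
    have "norm (real_of_int_vec k) \<le> real CARD('d) * real m"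
      using k norm_obs_cube_diff_le by (auto simp: diff_set_def)
    hence w: "?w \<le> ?W" "0 \<le> ?w" using \<beta> by (auto intro!: powr_mono2 add_nonneg_nonneg)
    have "\<bar>bump_cov \<theta> \<tau> b m j k\<bar> \<le> \<tau>\<^sup>2 * ((if k = 0 then 1 else 0) + real j * b\<^sup>2 * overlap ?B k * 1)"
    proof -
      have o: "0 \<le> real j * b\<^sup>2 * overlap ?B k"
        using overlap_bounds(1)[OF B] by (intro mult_nonneg_nonneg) auto
      have "\<bar>real j * b\<^sup>2 * overlap ?B k * cos (phase \<theta> k)\<bar> \<le> real j * b\<^sup>2 * overlap ?B k * 1"
        unfolding abs_mult[of _ "cos _"] abs_of_nonneg[OF o]
        by (rule mult_left_mono[OF abs_cos_le_one o])
      hence "\<bar>(if k = 0 then 1 else 0) + real j * b\<^sup>2 * overlap ?B k * cos (phase \<theta> k)\<bar> \<le>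
          (if k = 0 then 1 else 0) + real j * b\<^sup>2 * overlap ?B k * 1"
        by (rule order.trans[OF abs_triangle_ineq add_mono[rotated]]) simp
      thus ?thesis
        unfolding bump_cov_def abs_mult[of "\<tau>\<^sup>2"] abs_power2 by (rule mult_left_mono) simp
    qed
    hence "\<bar>bump_cov \<theta> \<tau> b m j k\<bar> * ?w \<le> (\<tau>\<^sup>2 * ((if k = 0 then 1 else 0) + real j * b\<^sup>2 * overlap ?B k * 1)) * ?w"
      using w by (intro mult_right_mono)
    \<comment> \<open>At lag 0 the weight is 1, since \<open>0 powr \<beta>\<close> is 0.\<close>
    also have "\<dots> = \<tau>\<^sup>2 * (if k = 0 then 1 else 0) + \<tau>\<^sup>2 * real j * b\<^sup>2 * overlap ?B k * ?w"
      using \<beta> by (simp add: algebra_simps)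
    also have "\<dots> \<le> \<tau>\<^sup>2 * (if k = 0 then 1 else 0) + \<tau>\<^sup>2 * real j * b\<^sup>2 * overlap ?B k * ?W"
      using overlap_bounds(1)[OF B, of k] by (intro add_mono mult_left_mono w) auto
    finally show ?thesis by (simp add: mult_ac)
  qed
  hence "(\<Sum>k\<in>diff_set ?B. \<bar>bump_cov \<theta> \<tau> b m j k\<bar> * (1 + norm (real_of_int_vec k) powr \<beta>)) \<le>
     (\<Sum>k\<in>diff_set ?B. \<tau>\<^sup>2 * (if k = 0 then 1 else 0) + overlap ?B k * (\<tau>\<^sup>2 * real j * b\<^sup>2 * ?W))"
    by (rule sum_mono)
  also have "\<dots> = (\<Sum>k\<in>diff_set ?B. \<tau>\<^sup>2 * (if k = 0 then 1 else 0)) + \<tau>\<^sup>2 * (real j * b\<^sup>2 * (real m ^ CARD('d))\<^sup>2 * ?W)"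
    unfolding sum.distrib sum_overlap[OF B] by (simp add: card_obs_cube power2_eq_square)
  also have "(\<Sum>k\<in>diff_set ?B. \<tau>\<^sup>2 * (if k = 0 then 1 else 0)) \<le> \<tau>\<^sup>2"
    using finite_diff_set[OF B] by (simp add: if_distrib cong: if_cong)
  also have "\<tau>\<^sup>2 * (real j * b\<^sup>2 * (real m ^ CARD('d))\<^sup>2 * ?W) \<le> \<tau>\<^sup>2 * 1"
    by (intro mult_left_mono b) auto
  finally show ?thesis by simp
qed

text \<open>Lag 0 is a difference of points of the nonempty cube, so the white-noise term vanishes
  off \<open>diff_set\<close> too.\<close>

lemma bump_cov_eq_0:
  fixes k :: "int ^ 'd"
  assumes "m \<ge> 1" "k \<notin> diff_set (obs_cube m)"
  shows "bump_cov \<theta> \<tau> b m j k = 0"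
proof -
  have "(1 :: int ^ 'd) \<in> obs_cube m" using assms(1) by (simp add: obs_cube_def)
  hence "0 \<in> diff_set (obs_cube m :: (int ^ 'd) set)" by (force simp: diff_set_def)
  thus ?thesis
    using assms overlap_eq_0[OF finite_obs_cube, of k m] by (auto simp: bump_cov_def)
qed

text \<open>The scalar spectral density belonging to autocovariances \<open>c\<close> that vanish
  off the finite set \<open>K\<close>.\<close>

definition trig_poly :: "(int ^ 'd \<Rightarrow> real) \<Rightarrow> (int ^ 'd) set \<Rightarrow> real ^ 'd \<Rightarrow> complex" where
  "trig_poly c K \<theta> = complex_of_real (1 / (2 * pi) ^ CARD('d)) *
     (\<Sum>k\<in>K. exp (\<i> * complex_of_real (phase \<theta> k)) * complex_of_real (c k))"

section \<open>Spectral densities of linear fields and membership in the class\<close>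

context
  fixes E :: "'h::{complex_hilbert, second_countable_topology} set" and e :: 'h
    and a :: "int ^ 'd \<Rightarrow> 'i \<Rightarrow> real" and c :: "int ^ 'd \<Rightarrow> real" and K
  assumes E: "complete_orthonormal_system E" and e: "e \<in> E"
    and fin: "\<And>t. finite {l. a t l \<noteq> 0}"
    and cov: "\<And>t k. (\<Sum>l | a (t + k) l \<noteq> 0. a (t + k) l * a t l) = c k"
    and K: "finite K" and c0: "\<And>k. k \<notin> K \<Longrightarrow> c k = 0"
begin

text \<open>Stated for a general weight: weight 1 yields existence of the spectral density, the
  polynomial weight the class constraint.\<close>

lemma infsum_trace_norm_autocov:
  assumes "\<And>k. w k \<ge> 0"
  shows "(\<Sum>\<^sub>\<infinity>k. trace_norm E (autocov (linear_field_law e a) coord k) * ennreal (w k)) =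
         ennreal (\<Sum>k\<in>K. \<bar>c k\<bar> * w k)"
proof -
  have "(\<Sum>\<^sub>\<infinity>k. trace_norm E (autocov (linear_field_law e a) coord k) * ennreal (w k)) =
        (\<Sum>\<^sub>\<infinity>k\<in>K. ennreal (\<bar>c k\<bar> * w k))"
    using assms
    by (intro infsum_cong_neutral)
       (auto simp: trace_norm_autocov_linear_field_law[OF E e fin cov] c0 ennreal_mult)
  thus ?thesis using K assms by (simp add: sum_ennreal)
qed

lemma has_spectral_density_linear_field_law:
  "has_spectral_density E (linear_field_law e a) coord (\<lambda>\<theta>\<in>freq_cube. rank_one e (trig_poly c K \<theta>))"
proof -
  have "(\<Sum>\<^sub>\<infinity>k. trace_norm E (autocov (linear_field_law e a) coord k)) < \<infinity>"
    using infsum_trace_norm_autocov[of "\<lambda>_. 1"] by simp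
  moreover have "rank_one e (trig_poly c K \<theta>) z = (1 / (2 * pi) ^ CARD('d)) *\<^sub>R
     (\<Sum>\<^sub>\<infinity>k. exp (\<i> * complex_of_real (real_of_int_vec k \<bullet> \<theta>)) *\<^sub>C autocov (linear_field_law e a) coord k z)" for \<theta> z
  proof -
    have "(\<Sum>\<^sub>\<infinity>k. exp (\<i> * complex_of_real (real_of_int_vec k \<bullet> \<theta>)) *\<^sub>C autocov (linear_field_law e a) coord k z) =
       (\<Sum>\<^sub>\<infinity>k\<in>K. (exp (\<i> * complex_of_real (phase \<theta> k)) * complex_of_real (c k) * cinner z e) *\<^sub>C e)"
      by (intro infsum_cong_neutral)
         (auto simp: autocov_linear_field_law[OF E e fin cov] rank_one_def c0 scaleC_scaleC mult.assoc phase_def)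
    also have "\<dots> = (\<Sum>k\<in>K. exp (\<i> * complex_of_real (phase \<theta> k)) * complex_of_real (c k) * cinner z e) *\<^sub>C e"
      using K by (simp add: scaleC_sum_left)
    finally show ?thesis
      by (simp add: rank_one_def trig_poly_def scaleR_scaleC scaleC_scaleC sum_distrib_right mult.assoc)
  qed
  ultimately show ?thesis
    unfolding has_spectral_density_def by (intro conjI restrict_ext ext)
qed

lemma linear_field_law_in_gaussian_laws:
  "linear_field_law e a \<in> gaussian_laws E (\<lambda>\<theta>\<in>freq_cube. rank_one e (trig_poly c K \<theta>))"
  unfolding gaussian_laws_def
  using sets_linear_field_law[OF E e fin cov] real_stationary_process_linear_field_law[OF E e fin cov]
    gaussian_process_linear_field_law[OF E e fin cov] has_spectral_density_linear_field_law
  by blast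

lemma linear_field_density_in_class:
  assumes "(\<Sum>k\<in>K. \<bar>c k\<bar> * (1 + norm (real_of_int_vec k) powr \<beta>)) \<le> L"
  shows "(\<lambda>\<theta>\<in>freq_cube. rank_one e (trig_poly c K \<theta>)) \<in> density_class E \<beta> L"
proof -
  have "(\<Sum>\<^sub>\<infinity>k. trace_norm E (autocov (linear_field_law e a) coord k) *
      ennreal (1 + norm (real_of_int_vec k) powr \<beta>)) \<le> ennreal L"
    using assms by (subst infsum_trace_norm_autocov) (auto intro: ennreal_leI add_nonneg_nonneg)
  thus ?thesis
    unfolding density_class_def
    using linear_field_law_in_gaussian_laws by (auto simp: gaussian_laws_def)
qed

end

lemma Re_trig_poly:
  "Re (trig_poly c K \<theta>) = (\<Sum>k\<in>K. cos (phase \<theta> k) * c k) / (2 * pi) ^ CARD('d)"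
  for \<theta> :: "real ^ 'd"
proof -
  have "Re (exp (\<i> * complex_of_real (phase \<theta> k)) * complex_of_real (c k)) = cos (phase \<theta> k) * c k" for k
    by (simp add: Re_exp Im_exp)
  hence "Re (\<Sum>k\<in>K. exp (\<i> * complex_of_real (phase \<theta> k)) * complex_of_real (c k)) =
         (\<Sum>k\<in>K. cos (phase \<theta> k) * c k)" by (simp only: Re_sum)
  moreover have "Re (complex_of_real x * z) = x * Re z" for x z by simp
  ultimately show ?thesis unfolding trig_poly_def by (simp only:) simp
qed

text \<open>The white-noise terms cancel. The layers are modulated at the very frequency
  \<open>\<theta>\<close> of evaluation, so the real part of the difference contains squared cosines
  and \<open>sum_overlap_cos_sq_ge\<close> excludes cancellation.\<close>

lemma trig_poly_bump_cov_gap: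
  fixes \<theta> :: "real ^ 'd" and m :: nat
  defines "K \<equiv> diff_set (obs_cube m :: (int ^ 'd) set)"
  shows "cmod (trig_poly (bump_cov \<theta> \<tau> b m j) K \<theta> - trig_poly (bump_cov \<theta> \<tau> b m 0) K \<theta>) \<ge>
     \<tau>\<^sup>2 * real j * b\<^sup>2 * (real m ^ CARD('d))\<^sup>2 / 2 / (2 * pi) ^ CARD('d)"
proof -
  let ?B = "obs_cube m :: (int ^ 'd) set"
  have "\<tau>\<^sup>2 * real j * b\<^sup>2 * (real m ^ CARD('d))\<^sup>2 / 2 \<le>
     \<tau>\<^sup>2 * real j * b\<^sup>2 * (\<Sum>k\<in>K. overlap ?B k * (cos (phase \<theta> k))\<^sup>2)"
    using mult_left_mono[OF sum_overlap_cos_sq_ge[of ?B \<theta>], of "\<tau>\<^sup>2 * real j * b\<^sup>2"]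
    by (simp add: K_def finite_obs_cube card_obs_cube)
  also have "\<dots> = (\<Sum>k\<in>K. cos (phase \<theta> k) * bump_cov \<theta> \<tau> b m j k) - (\<Sum>k\<in>K. cos (phase \<theta> k) * bump_cov \<theta> \<tau> b m 0 k)"
    unfolding sum_subtractf[symmetric] sum_distrib_left
    by (intro sum.cong refl) (simp add: bump_cov_def power2_eq_square algebra_simps)
  finally have "\<tau>\<^sup>2 * real j * b\<^sup>2 * (real m ^ CARD('d))\<^sup>2 / 2 / (2 * pi) ^ CARD('d) \<le>
     Re (trig_poly (bump_cov \<theta> \<tau> b m j) K \<theta> - trig_poly (bump_cov \<theta> \<tau> b m 0) K \<theta>)"
    unfolding minus_complex.simps Re_trig_poly diff_divide_distrib[symmetric]
    by (rule divide_right_mono) simp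
  thus ?thesis using complex_Re_le_cmod order.trans by blast
qed

section \<open>The effect of one more layer on the probability of an observable event\<close>

lemma linear_field_bump_field:
  assumes "finite U" "(\<lambda>v. t + v) ` obs_cube m \<subseteq> U"
  shows "linear_field (bump_field \<theta> \<tau> b m j) t \<omega> =
     \<tau> * (\<omega> (Inl t) + (\<Sum>(u, i, \<sigma>)\<in>U \<times> {..<j} \<times> UNIV. bump \<theta> b m t u \<sigma> * \<omega> (Inr (u, i, \<sigma>))))"
proof -
  have "linear_field (bump_field \<theta> \<tau> b m j) t \<omega> = 
     (\<Sum>l\<in>insert (Inl t) (Inr ` (U \<times> {..<j} \<times> UNIV)). bump_field \<theta> \<tau> b m j t l * \<omega> l)"
    using assms bump_field_support[OF _ assms(2)] by (intro linear_field_eq_sum) auto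
  also have "\<dots> = \<tau> * \<omega> (Inl t) + (\<Sum>p\<in>U \<times> {..<j} \<times> UNIV. bump_field \<theta> \<tau> b m j t (Inr p) * \<omega> (Inr p))"
    using assms by (subst sum.insert) (auto simp: sum.reindex bump_field_def)
  also have "(\<Sum>p\<in>U \<times> {..<j} \<times> UNIV. bump_field \<theta> \<tau> b m j t (Inr p) * \<omega> (Inr p)) =
     \<tau> * (\<Sum>(u, i, \<sigma>)\<in>U \<times> {..<j} \<times> UNIV. bump \<theta> b m t u \<sigma> * \<omega> (Inr (u, i, \<sigma>)))"
    unfolding sum_distrib_left by (intro sum.cong refl) (auto simp: bump_field_def)
  finally show ?thesis by (simp add: algebra_simps)
qed

text \<open>An instance of \<open>gauss_perturbation_le\<close>: the observed cube depends on
  finitely many noise coordinates only, split into white noise, new layer and earlier layers.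
  Hypothesis \<open>b\<close> bounds the squared Hilbert--Schmidt norm of the covariance of the new
  layer, with one factor \<open>n ^ CARD('d)\<close> for the points and the rest from
  \<open>sum_overlap_sq_le\<close>.\<close>

lemma bump_field_law_step:
  fixes \<theta> :: "real ^ 'd" and e :: "'h::{complex_hilbert, second_countable_topology}"
    and A :: "(int ^ 'd \<Rightarrow> 'h) set" and \<tau> b :: real
  assumes A[measurable]: "A \<in> sets (\<Pi>\<^sub>M t\<in>obs_cube n. borel)"
    and b: "b ^ 4 * real n ^ CARD('d) * (real m ^ CARD('d)) ^ 3 \<le> 1 / 2"
  defines "p j \<equiv> emeasure (linear_field_law e (bump_field \<theta> \<tau> b m j))
                   {\<omega> \<in> space path_space. restrict \<omega> (obs_cube n) \<in> A}"
  shows "(p (Suc j))\<^sup>2 \<le> 2 * p j"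
proof -
  let ?C = "obs_cube n :: (int ^ 'd) set"
  define U where "U = (\<lambda>(t, v). t + v) ` (?C \<times> obs_cube m)"
  have U: "finite U" by (simp add: U_def finite_obs_cube)
  have sub: "(\<lambda>v. t + v) ` obs_cube m \<subseteq> U" if "t \<in> ?C" for t
    using that by (auto simp: U_def)
  \<comment> \<open>\<open>D\<close> is the white noise on the observed cube, \<open>G\<close> the
    noise of layer number \<open>j\<close>, which is the one added, and \<open>R\<close> that of the
    layers below \<open>j\<close>.\<close>
  define D where "D = (Inl ` ?C :: 'd noise set)"
  define G where "G = (Inr ` (U \<times> {j} \<times> UNIV) :: 'd noise set)"
  define R where "R = (Inr ` (U \<times> {..<j} \<times> UNIV) :: 'd noise set)"
  define I where "I = R \<union> (G \<union> D)"
  have DGR: "finite D" "finite G" "finite R" "D \<inter> G = {}" "D \<inter> R = {}" "G \<inter> R = {}"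
    using U by (auto simp: D_def G_def R_def finite_obs_cube)
  have I: "finite I" using DGR by (simp add: I_def)
  define M :: "'d noise \<Rightarrow> 'd noise \<Rightarrow> real" where
    "M l q = (case (l, q) of (Inl t, Inr (u, i, \<sigma>)) \<Rightarrow> bump \<theta> b m t u \<sigma> | _ \<Rightarrow> 0)" for l q
  define r where "r l \<omega> = (\<Sum>q\<in>R. M l q * \<omega> q)" for l \<omega>
  have [measurable]: "r l \<in> borel_measurable (gauss R)" for l
    unfolding r_def[abs_def] by measurable
  \<comment> \<open>The event is pulled back to real coordinates; it absorbs the scale
    \<open>\<tau>\<close> and the direction \<open>e\<close>.\<close>
  define A' where "A' = {x \<in> space (gauss D). (\<lambda>t\<in>?C. (\<tau> * x (Inl t)) *\<^sub>R e) \<in> A}"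
  have "(\<lambda>x. \<lambda>t\<in>?C. (\<tau> * x (Inl t)) *\<^sub>R e) \<in> gauss D \<rightarrow>\<^sub>M (\<Pi>\<^sub>M t\<in>?C. borel)"
    by (intro measurable_restrict) (auto simp: D_def)
  hence A'[measurable]: "A' \<in> sets (gauss D)"
    unfolding A'_def by measurable
  \<comment> \<open>Reduction from the path space to the infinite noise space and from there to the
    finite block \<open>I\<close>.\<close>
  have law: "emeasure (linear_field_law e a) {\<omega> \<in> space path_space. restrict \<omega> ?C \<in> A} = (\<integral>\<^sup>+\<omega>. F \<omega> \<partial>gauss I)"
    if F[measurable]: "F \<in> borel_measurable (gauss I)"
      and fin: "\<And>t. finite {l. a t l \<noteq> 0}"
      and eq: "\<And>\<omega>. indicator A (\<lambda>t\<in>?C. linear_field a t \<omega> *\<^sub>R e) = F (restrict \<omega> I)" for F a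
  proof -
    have lm: "(\<lambda>\<omega> t. linear_field a t \<omega> *\<^sub>R e) \<in> gauss UNIV \<rightarrow>\<^sub>M path_space"
      unfolding path_space_def
      by (rule measurable_PiM_single') (auto intro!: borel_measurable_scaleR measurable_linear_field fin)
    have "(\<lambda>\<omega>. restrict \<omega> ?C) \<in> (path_space :: (int ^ 'd \<Rightarrow> 'h) measure) \<rightarrow>\<^sub>M (\<Pi>\<^sub>M t\<in>?C. borel)"
      unfolding path_space_def by (rule measurable_restrict_subset) simp
    hence ev: "{\<omega> \<in> space path_space. restrict \<omega> ?C \<in> A} \<in> sets path_space"
      by measurable
    have "emeasure (linear_field_law e a) {\<omega> \<in> space path_space. restrict \<omega> ?C \<in> A} =
       (\<integral>\<^sup>+\<omega>. indicator {\<omega> \<in> space path_space. restrict \<omega> ?C \<in> A} \<omega> \<partial>linear_field_law e a)"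
      using ev by (simp add: linear_field_law_def)
    also have "\<dots> = (\<integral>\<^sup>+\<omega>. indicator A (\<lambda>t\<in>?C. linear_field a t \<omega> *\<^sub>R e) \<partial>gauss UNIV)"
      unfolding linear_field_law_def using ev
      by (subst nn_integral_distr[OF lm])
         (auto intro!: nn_integral_cong simp: indicator_def path_space_def space_PiM)
    also have "\<dots> = (\<integral>\<^sup>+\<omega>. F (restrict \<omega> I) \<partial>gauss UNIV)"
      by (simp only: eq)
    also have "\<dots> = (\<integral>\<^sup>+\<omega>. F \<omega> \<partial>distr (gauss UNIV) (gauss I) (\<lambda>\<omega>. restrict \<omega> I))"
      by (intro nn_integral_distr[symmetric] measurable_restrict_subset) auto
    also have "distr (gauss UNIV) (gauss I) (\<lambda>\<omega>. restrict \<omega> I) = gauss I"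
      by (rule gauss.distr_PiM_restrict_finite[OF I]) simp
    finally show ?thesis .
  qed
  have r_eq: "r (Inl t) \<omega> = (\<Sum>(u, i, \<sigma>)\<in>U \<times> {..<j} \<times> UNIV. bump \<theta> b m t u \<sigma> * \<omega> (Inr (u, i, \<sigma>)))" for t \<omega>
    unfolding r_def R_def by (subst sum.reindex) (auto simp: M_def intro!: sum.cong)
  have G_eq: "(\<Sum>q\<in>G. M (Inl t) q * \<omega> q) = 
     (\<Sum>(u, i, \<sigma>)\<in>U \<times> {j} \<times> UNIV. bump \<theta> b m t u \<sigma> * \<omega> (Inr (u, i, \<sigma>)))" for t \<omega>
    unfolding G_def by (subst sum.reindex) (auto simp: M_def intro!: sum.cong)
  have r_restrict: "r l (restrict \<omega> R) = r l \<omega>" "restrict (restrict \<omega> I) R = restrict \<omega> R" for l \<omega>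
    by (auto simp: r_def I_def restrict_def)
  have field0: "linear_field (bump_field \<theta> \<tau> b m j) t \<omega> = \<tau> * (\<omega> (Inl t) + r (Inl t) \<omega>)" if "t \<in> ?C" for t \<omega>
    using linear_field_bump_field[OF U sub[OF that]] by (simp add: r_eq)
  have field1: "linear_field (bump_field \<theta> \<tau> b m (Suc j)) t \<omega> =
       \<tau> * (\<omega> (Inl t) + r (Inl t) \<omega> + (\<Sum>q\<in>G. M (Inl t) q * \<omega> q))" if "t \<in> ?C" for t \<omega>
  proof -
    have "U \<times> {..<Suc j} \<times> (UNIV :: bool set) = U \<times> {..<j} \<times> UNIV \<union> U \<times> {j} \<times> UNIV"
      by (auto simp: lessThan_Suc)
    moreover have "(\<Sum>p\<in>U \<times> {..<j} \<times> UNIV \<union> U \<times> {j} \<times> (UNIV :: bool set). g p) =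
       (\<Sum>p\<in>U \<times> {..<j} \<times> UNIV. g p) + (\<Sum>p\<in>U \<times> {j} \<times> UNIV. g p)" for g :: "_ \<Rightarrow> real"
      using U by (intro sum.union_disjoint) auto
    ultimately show ?thesis
      using linear_field_bump_field[OF U sub[OF that]] by (simp only: r_eq G_eq add.assoc)
  qed
  have A'_eq: "indicator A (\<lambda>t\<in>?C. (\<tau> * y (Inl t)) *\<^sub>R e) = (indicator A' (restrict y D) :: ennreal)" for y
  proof -
    have "(\<lambda>t\<in>?C. (\<tau> * restrict y D (Inl t)) *\<^sub>R e) = (\<lambda>t\<in>?C. (\<tau> * y (Inl t)) *\<^sub>R e)"
      by (intro restrict_ext) (auto simp: D_def)
    thus ?thesis by (auto simp: A'_def indicator_def space_PiM)
  qed
  have p0: "p j = (\<integral>\<^sup>+\<omega>. indicator A' (\<lambda>l\<in>D. \<omega> l + r l (restrict \<omega> R)) \<partial>gauss I)"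
    unfolding p_def
  proof (rule law)
    fix \<omega> :: "'d noise \<Rightarrow> real"
    have "(\<lambda>t\<in>?C. linear_field (bump_field \<theta> \<tau> b m j) t \<omega> *\<^sub>R e) =
          (\<lambda>t\<in>?C. (\<tau> * (\<omega> (Inl t) + r (Inl t) \<omega>)) *\<^sub>R e)"
      by (intro restrict_ext) (simp add: field0)
    moreover have "(\<lambda>l\<in>D. restrict \<omega> I l + r l (restrict (restrict \<omega> I) R)) = (\<lambda>l\<in>D. \<omega> l + r l \<omega>)"
      unfolding r_restrict by (intro restrict_ext) (simp add: I_def)
    ultimately show "indicator A (\<lambda>t\<in>?C. linear_field (bump_field \<theta> \<tau> b m j) t \<omega> *\<^sub>R e) =
       (indicator A' (\<lambda>l\<in>D. restrict \<omega> I l + r l (restrict (restrict \<omega> I) R)) :: ennreal)"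
      using A'_eq[of "\<lambda>l. \<omega> l + r l \<omega>"] by simp
  qed (use finite_bump_field_support in \<open>auto simp: I_def\<close>)
  have p1: "p (Suc j) = (\<integral>\<^sup>+\<omega>. indicator A' (\<lambda>l\<in>D. \<omega> l + r l (restrict \<omega> R) + (\<Sum>q\<in>G. M l q * \<omega> q)) \<partial>gauss I)"
    unfolding p_def
  proof (rule law)
    fix \<omega> :: "'d noise \<Rightarrow> real"
    have "(\<lambda>t\<in>?C. linear_field (bump_field \<theta> \<tau> b m (Suc j)) t \<omega> *\<^sub>R e) =
          (\<lambda>t\<in>?C. (\<tau> * (\<omega> (Inl t) + r (Inl t) \<omega> + (\<Sum>q\<in>G. M (Inl t) q * \<omega> q))) *\<^sub>R e)"
      by (intro restrict_ext) (simp add: field1)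
    moreover have "(\<lambda>l\<in>D. restrict \<omega> I l + r l (restrict (restrict \<omega> I) R) + (\<Sum>q\<in>G. M l q * restrict \<omega> I q)) =
        (\<lambda>l\<in>D. \<omega> l + r l \<omega> + (\<Sum>q\<in>G. M l q * \<omega> q))"
      unfolding r_restrict by (intro restrict_ext) (simp add: I_def)
    ultimately show "indicator A (\<lambda>t\<in>?C. linear_field (bump_field \<theta> \<tau> b m (Suc j)) t \<omega> *\<^sub>R e) =
       (indicator A' (\<lambda>l\<in>D. restrict \<omega> I l + r l (restrict (restrict \<omega> I) R) + (\<Sum>q\<in>G. M l q * restrict \<omega> I q)) :: ennreal)"
      using A'_eq[of "\<lambda>l. \<omega> l + r l \<omega> + (\<Sum>q\<in>G. M l q * \<omega> q)"] by simp
  qed (use finite_bump_field_support in \<open>auto simp: I_def\<close>)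
  have "(\<Sum>k\<in>D. \<Sum>l\<in>D. (\<Sum>q\<in>G. M k q * M l q)\<^sup>2) =
     (\<Sum>s\<in>?C. \<Sum>t\<in>?C. (b\<^sup>2 * overlap (obs_cube m) (s - t) * cos (phase \<theta> (s - t)))\<^sup>2)"
  proof -
    have "(\<Sum>q\<in>G. M (Inl s) q * M (Inl t) q) = b\<^sup>2 * overlap (obs_cube m) (s - t) * cos (phase \<theta> (s - t))"
      if "t \<in> ?C" for s t
    proof -
      have "(\<Sum>q\<in>G. M (Inl s) q * M (Inl t) q) =
         (\<Sum>(u, i, \<sigma>)\<in>U \<times> {j} \<times> UNIV. bump \<theta> b m s u \<sigma> * bump \<theta> b m t u \<sigma>)"
        unfolding G_def by (subst sum.reindex) (auto simp: M_def intro!: sum.cong)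
      also have "\<dots> = (\<Sum>u\<in>U. \<Sum>\<sigma>\<in>UNIV. bump \<theta> b m s u \<sigma> * bump \<theta> b m t u \<sigma>)"
        by (simp flip: sum.cartesian_product)
      finally show ?thesis using bump_gram[OF U sub[OF that]] by simp
    qed
    thus ?thesis unfolding D_def by (simp add: sum.reindex)
  qed
  also have "\<dots> \<le> (\<Sum>s\<in>?C. \<Sum>t\<in>?C. b ^ 4 * (overlap (obs_cube m) (s - t))\<^sup>2)"
  proof (intro sum_mono)
    fix s t :: "int ^ 'd"
    have "b ^ 4 * (overlap (obs_cube m) (s - t))\<^sup>2 * (cos (phase \<theta> (s - t)))\<^sup>2 \<le>
       b ^ 4 * (overlap (obs_cube m) (s - t))\<^sup>2 * 1"
      by (intro mult_left_mono) (auto simp: abs_square_le_1)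
    thus "(b\<^sup>2 * overlap (obs_cube m) (s - t) * cos (phase \<theta> (s - t)))\<^sup>2 \<le> b ^ 4 * (overlap (obs_cube m) (s - t))\<^sup>2"
      by (simp add: power_mult_distrib flip: power_mult)
  qed
  also have "\<dots> = (\<Sum>s\<in>?C. b ^ 4 * (\<Sum>t\<in>?C. (overlap (obs_cube m) (s - t))\<^sup>2))"
    by (simp add: sum_distrib_left)
  also have "\<dots> \<le> (\<Sum>s\<in>?C. b ^ 4 * (real (card (obs_cube m :: (int ^ 'd) set)) ^ 3))"
    by (intro sum_mono mult_left_mono sum_overlap_sq_le finite_obs_cube) auto
  also have "\<dots> = b ^ 4 * real n ^ CARD('d) * (real m ^ CARD('d)) ^ 3"
    by (simp add: card_obs_cube)
  also note b
  finally have "(\<Sum>k\<in>D. \<Sum>l\<in>D. (\<Sum>q\<in>G. M k q * M l q)\<^sup>2) \<le> 1 / 2" .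
  thus ?thesis
    unfolding p0 p1 I_def by (intro gauss_perturbation_le DGR) measurable
qed

text \<open>For \<open>q j / 2\<close> the recursion says that each square is at most the preceding
  term, so the power \<open>2 ^ j\<close> of the term of index \<open>j\<close> stays below the
  first one.\<close>

lemma sqrt_recursion_lt_half:
  fixes q :: "nat \<Rightarrow> real"
  assumes q: "\<And>j. q j \<ge> 0" "\<And>j. (q (Suc j))\<^sup>2 \<le> 2 * q j" and q0: "q 0 < 2 * (1 / 4) ^ 2 ^ J"
  shows "q J < 1 / 2"
proof -
  have "(q j / 2) ^ 2 ^ j \<le> q 0 / 2" for j
  proof (induction j)
    case (Suc j)
    have "(q (Suc j) / 2)\<^sup>2 \<le> q j / 2" using q(2)[of j] by (simp add: power_divide)
    hence "((q (Suc j) / 2)\<^sup>2) ^ 2 ^ j \<le> (q j / 2) ^ 2 ^ j" by (intro power_mono) auto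
    also note Suc
    finally show ?case by (simp flip: power_mult)
  qed simp
  from this[of J] q0 have "(q J / 2) ^ 2 ^ J < (1 / 4) ^ 2 ^ J" by simp
  hence "q J / 2 < 1 / 4" by (rule power_less_imp_less_base) simp
  thus ?thesis by simp
qed

section \<open>The lower bound\<close>

text \<open>With \<open>r n\<close> of order \<open>n powr (d / (2 * \<beta> + d))\<close>, its
  power \<open>\<beta>\<close> is the inverse rate and its power \<open>d + 2 * \<beta>\<close> is
  \<open>n ^ d\<close>. Taking \<open>m\<close> proportional to \<open>r n\<close> meets both
  conditions up to constants: the proportionality factor settles the first, and \<open>J\<close>,
  chosen independently of \<open>n\<close>, the second.\<close>

lemma bump_parameters_exist:
  fixes \<beta> \<kappa> :: real and d :: nat
  assumes \<beta>: "\<beta> > 0" and \<kappa>: "\<kappa> > 0" and d: "d > 0"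
  shows "\<exists>J m. J \<ge> 1 \<and> (\<forall>\<^sub>F n in sequentially. m n \<ge> 1 \<and>
     1 + (real d * real (m n)) powr \<beta> \<le> \<kappa> * real n powr (real d * \<beta> / (2 * \<beta> + real d)) \<and>
     2 * real n ^ d \<le> (real J)\<^sup>2 * real (m n) ^ d * (1 + (real d * real (m n)) powr \<beta>)\<^sup>2)"
proof -
  \<comment> \<open>Chosen so that the power term uses only half of \<open>\<kappa>\<close>; the
    other half absorbs the summand 1 once \<open>n\<close> is large.\<close>
  define B where "B = (\<kappa> / 2) powr (1 / \<beta>) / real d"
  have B: "B > 0" using \<kappa> d by (simp add: B_def)
  define r where "r n = real n powr (real d / (2 * \<beta> + real d))" for n
  define m where "m n = nat \<lfloor>B * r n\<rfloor>" for n
  obtain J :: nat where J: "J \<ge> 1" "2 \<le> (real J)\<^sup>2 * (B / 2) powr (real d + 2 * \<beta>)"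
  proof -
    define x where "x = (B / 2) powr (real d + 2 * \<beta>)"
    have x: "x > 0" using B by (simp add: x_def)
    obtain J :: nat where "J > max 1 (2 / x)" using reals_Archimedean2 by blast
    hence J1: "real J \<ge> 1" and J2: "real J * x \<ge> 2" using x by (auto simp: field_simps)
    have "2 \<le> real J * x" by (rule J2)
    also have "\<dots> \<le> real J * real J * x" using J1 x by (intro mult_right_mono) auto
    finally show ?thesis using J1 by (intro that[of J]) (auto simp: x_def power2_eq_square)
  qed
  have lim: "filterlim r at_top sequentially"
    unfolding r_def[abs_def] using \<beta> d
    by (intro filterlim_compose[OF real_powr_at_top filterlim_real_sequentially]) auto
  \<comment> \<open>Then \<open>B * r n\<close> is at least 2, and rounding down loses at most half
    of it.\<close>
  have ev1: "\<forall>\<^sub>F n in sequentially. r n \<ge> 2 / B"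
    using lim unfolding filterlim_at_top by blast
  have ev2: "\<forall>\<^sub>F n in sequentially. r n \<ge> (2 / \<kappa>) powr (1 / \<beta>)"
    using lim unfolding filterlim_at_top by blast
  have "\<forall>\<^sub>F n in sequentially. m n \<ge> 1 \<and>
     1 + (real d * real (m n)) powr \<beta> \<le> \<kappa> * real n powr (real d * \<beta> / (2 * \<beta> + real d)) \<and>
     2 * real n ^ d \<le> (real J)\<^sup>2 * real (m n) ^ d * (1 + (real d * real (m n)) powr \<beta>)\<^sup>2"
    using ev1 ev2 eventually_gt_at_top[of 0]
  proof eventually_elim
    case (elim n)
    have Br: "B * r n \<ge> 2" using elim(1) B by (simp add: field_simps)
    have m_le: "real (m n) \<le> B * r n" and m_ge: "real (m n) \<ge> B * r n / 2"
      using Br unfolding m_def by linarith+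
    have m1: "m n \<ge> 1" using Br unfolding m_def by linarith
    have r0: "r n > 0" using elim(3) by (simp add: r_def)
    have r\<beta>: "r n powr \<beta> = real n powr (real d * \<beta> / (2 * \<beta> + real d))"
      by (simp add: r_def powr_powr)
    have "(real d * real (m n)) powr \<beta> \<le> ((\<kappa> / 2) powr (1 / \<beta>) * r n) powr \<beta>"
      using m_le d \<beta> by (intro powr_mono2) (auto simp: B_def field_simps)
    also have "\<dots> = \<kappa> / 2 * r n powr \<beta>"
      using \<beta> \<kappa> r0 by (simp add: powr_mult powr_powr)
    finally have W1: "(real d * real (m n)) powr \<beta> \<le> \<kappa> / 2 * r n powr \<beta>" .
    have "2 / \<kappa> = ((2 / \<kappa>) powr (1 / \<beta>)) powr \<beta>"
      using \<beta> \<kappa> by (simp add: powr_powr)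
    also have "\<dots> \<le> r n powr \<beta>" using elim(2) \<beta> by (intro powr_mono2) auto
    finally have "1 \<le> \<kappa> / 2 * r n powr \<beta>" using \<kappa> by (simp add: field_simps)
    with W1 have W: "1 + (real d * real (m n)) powr \<beta> \<le> \<kappa> * r n powr \<beta>" by (simp add: field_simps)
    have nd: "real n ^ d = r n powr (real d + 2 * \<beta>)"
      using elim(3) \<beta> by (simp add: r_def powr_powr add.commute powr_realpow)
    have "2 * r n powr (real d + 2 * \<beta>) \<le> ((real J)\<^sup>2 * (B / 2) powr (real d + 2 * \<beta>)) * r n powr (real d + 2 * \<beta>)"
      by (rule mult_right_mono[OF J(2)]) simp
    also have "(real J)\<^sup>2 * (B / 2) powr (real d + 2 * \<beta>) * r n powr (real d + 2 * \<beta>) = 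
        (real J)\<^sup>2 * (B * r n / 2) powr (real d + 2 * \<beta>)"
      using B r0 by (simp flip: powr_mult add: mult.assoc)
    also have "\<dots> \<le> (real J)\<^sup>2 * real (m n) powr (real d + 2 * \<beta>)"
      using m_ge B r0 \<beta> by (intro mult_left_mono powr_mono2) auto
    also have "\<dots> = (real J)\<^sup>2 * real (m n) ^ d * (real (m n) powr \<beta>)\<^sup>2"
    proof -
      have "real (m n) powr (2 * \<beta>) = (real (m n) powr \<beta>)\<^sup>2"
        by (simp add: power2_eq_square flip: powr_add)
      thus ?thesis using m1 by (simp add: powr_add powr_realpow)
    qed
    also have "\<dots> \<le> (real J)\<^sup>2 * real (m n) ^ d * (1 + (real d * real (m n)) powr \<beta>)\<^sup>2"
    proof (intro mult_left_mono power_mono)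
      have "real (m n) powr \<beta> \<le> (real d * real (m n)) powr \<beta>"
        using d \<beta> by (intro powr_mono2) (auto simp: mult_le_cancel_right1)
      thus "real (m n) powr \<beta> \<le> 1 + (real d * real (m n)) powr \<beta>" by simp
    qed auto
    finally show ?case using m1 W by (simp add: r\<beta> nd)
  qed
  thus ?thesis using J(1) by blast
qed

text \<open>The hypotheses to be compared have no layer and \<open>J\<close> layers. If the
  estimator rarely fails under the first, the same failure event still has probability below 1/2
  under the second; off that event the estimate is within \<open>\<psi>\<close> of the first
  density, hence by the triangle inequality at least \<open>\<psi>\<close> from the second.\<close>

lemma estimation_error_two_points:
  fixes E :: "'h::{complex_hilbert, second_countable_topology} set" and \<theta>\<^sub>0 :: "real ^ 'd" and \<tau> :: real
  assumes E: "complete_orthonormal_system E" and e: "e \<in> E" and \<theta>\<^sub>0: "\<theta>\<^sub>0 \<in> freq_cube"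
    and fn: "fn \<in> estimators E n" and \<beta>: "\<beta> > 0" and m: "m \<ge> 1" and J: "J \<ge> 1"
  defines "d \<equiv> CARD('d)"
  defines "W \<equiv> 1 + (real d * real m) powr \<beta>"
  assumes \<psi>: "2 * \<psi> \<le> \<tau>\<^sup>2 / (2 * W * (2 * pi) ^ d)"
    and J_large: "2 * real n ^ d \<le> (real J)\<^sup>2 * real m ^ d * W\<^sup>2"
    and L: "2 * \<tau>\<^sup>2 \<le> L"
  shows "ennreal (2 * (1 / 4) ^ 2 ^ J) \<le> (SUP f\<in>density_class E \<beta> L. SUP P\<in>gaussian_laws E f.
      emeasure P {\<omega> \<in> space P. hs_norm E (\<lambda>x. fn \<theta>\<^sub>0 (restrict \<omega> (obs_cube n)) x - f \<theta>\<^sub>0 x) \<ge> \<psi>})"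
    (is "?p \<le> ?sup")
proof -
  interpret H: Metric_space "hs_operators E" "hs_dist E" by (rule Metric_space_hs[OF E])
  let ?C = "obs_cube n :: (int ^ 'd) set"
  define K where "K = diff_set (obs_cube m :: (int ^ 'd) set)"
  define N where "N = real m ^ d"
  have N: "N > 0" and W: "W \<ge> 1" using m by (auto simp: N_def W_def)
  \<comment> \<open>The amplitude for which \<open>J\<close> layers exhaust the bound required by
    \<open>sum_abs_bump_cov_le\<close>.\<close>
  define b where "b = sqrt (1 / (real J * N\<^sup>2 * W))"
  have b2: "b\<^sup>2 = 1 / (real J * N\<^sup>2 * W)" using N W by (simp add: b_def)
  have J0: "real J > 0" using J by simp
  define P where "P j = linear_field_law e (bump_field \<theta>\<^sub>0 \<tau> b m j)" for j
  define c where "c j = bump_cov \<theta>\<^sub>0 \<tau> b m j" for j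
  define f where "f j = (\<lambda>\<theta>\<in>freq_cube. rank_one e (trig_poly (c j) K \<theta>))" for j
  have fin: "finite {l. bump_field \<theta>\<^sub>0 \<tau> b m j t l \<noteq> 0}" for j t
    by (rule finite_bump_field_support)
  have cov: "(\<Sum>l | bump_field \<theta>\<^sub>0 \<tau> b m j (t + k) l \<noteq> 0.
      bump_field \<theta>\<^sub>0 \<tau> b m j (t + k) l * bump_field \<theta>\<^sub>0 \<tau> b m j t l) = c j k" for j t k
    unfolding c_def by (rule bump_field_cov)
  have K: "finite K" unfolding K_def by (intro finite_diff_set finite_obs_cube)
  have c0: "c j k = 0" if "k \<notin> K" for j k
    using that m unfolding c_def K_def by (intro bump_cov_eq_0)
  note field = E e fin cov K c0
  have P_law: "P j \<in> gaussian_laws E (f j)" for j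
    unfolding P_def f_def by (rule linear_field_law_in_gaussian_laws[OF field])
  have f_class: "f j \<in> density_class E \<beta> L" if "j \<le> J" for j
    unfolding f_def
  proof (rule linear_field_density_in_class[OF field])
    have "real j * b\<^sup>2 * N\<^sup>2 * W = real j / real J"
      using N W J0 by (simp add: b2 field_simps)
    also have "\<dots> \<le> 1" using that J0 by simp
    finally have "(\<Sum>k\<in>K. \<bar>c j k\<bar> * (1 + norm (real_of_int_vec k) powr \<beta>)) \<le> 2 * \<tau>\<^sup>2"
      unfolding c_def K_def N_def W_def d_def by (intro sum_abs_bump_cov_le m \<beta>)
    thus "(\<Sum>k\<in>K. \<bar>c j k\<bar> * (1 + norm (real_of_int_vec k) powr \<beta>)) \<le> L" using L by simp
  qed
  have f_hs: "f j \<theta>\<^sub>0 \<in> hs_operators E" for j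
    using \<theta>\<^sub>0 hs_operators_rank_one[OF E e] by (simp add: f_def)
  have gap: "hs_dist E (f J \<theta>\<^sub>0) (f 0 \<theta>\<^sub>0) \<ge> 2 * \<psi>"
  proof -
    have "2 * \<psi> \<le> \<tau>\<^sup>2 / (2 * W * (2 * pi) ^ d)" by (rule \<psi>)
    also have "\<dots> = \<tau>\<^sup>2 * real J * b\<^sup>2 * N\<^sup>2 / 2 / (2 * pi) ^ d"
      using N W J0 by (simp add: b2 field_simps)
    also have "\<dots> \<le> cmod (trig_poly (c J) K \<theta>\<^sub>0 - trig_poly (c 0) K \<theta>\<^sub>0)"
      unfolding c_def K_def N_def d_def by (rule trig_poly_bump_cov_gap)
    finally show ?thesis using \<theta>\<^sub>0 by (simp add: f_def hs_dist_rank_one[OF E e])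
  qed
  have fn_meas [measurable]: "fn \<theta>\<^sub>0 \<in> (\<Pi>\<^sub>M t\<in>?C. borel) \<rightarrow>\<^sub>M hs_borel E"
    using fn \<theta>\<^sub>0 by (auto simp: estimators_def)
  define A where "A j = {x \<in> space (\<Pi>\<^sub>M t\<in>?C. borel). hs_dist E (fn \<theta>\<^sub>0 x) (f j \<theta>\<^sub>0) \<ge> \<psi>}" for j
  have fn_hs: "fn \<theta>\<^sub>0 x \<in> hs_operators E" if "x \<in> space (\<Pi>\<^sub>M t\<in>?C. borel)" for x
    using measurable_space[OF fn_meas that] by (simp add: sets_hs_dist_ge(2)[OF E f_hs])
  have A_sets: "A j \<in> sets (\<Pi>\<^sub>M t\<in>?C. borel)" for j
  proof -
    have "A j = fn \<theta>\<^sub>0 -` {B \<in> hs_operators E. hs_dist E B (f j \<theta>\<^sub>0) \<ge> \<psi>} \<inter> space (\<Pi>\<^sub>M t\<in>?C. borel)"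
      using fn_hs by (auto simp: A_def)
    thus ?thesis using measurable_sets[OF fn_meas sets_hs_dist_ge(1)[OF E f_hs]] by simp
  qed
  define Ev where "Ev j = {\<omega> \<in> space path_space. restrict \<omega> ?C \<in> A j}" for j
  have setsP: "sets (P j) = sets path_space" and prob: "prob_space (P j)" for j
    using P_law[of j] by (auto simp: gaussian_laws_def real_stationary_process_def)
  have Ev_sets: "Ev j \<in> sets path_space" for j
  proof -
    have "(\<lambda>\<omega>. restrict \<omega> ?C) \<in> (path_space :: (int ^ 'd \<Rightarrow> 'h) measure) \<rightarrow>\<^sub>M (\<Pi>\<^sub>M t\<in>?C. borel)"
      unfolding path_space_def by (rule measurable_restrict_subset) simp
    from measurable_sets[OF this A_sets[of j]] show ?thesis by (simp add: Ev_def vimage_def Int_def conj_commute)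
  qed
  have Ev_eq: "{\<omega> \<in> space (P j). hs_norm E (\<lambda>x. fn \<theta>\<^sub>0 (restrict \<omega> ?C) x - f j \<theta>\<^sub>0 x) \<ge> \<psi>} = Ev j" for j
    using sets_eq_imp_space_eq[OF setsP[of j]]
    by (auto simp: Ev_def A_def hs_dist_def space_PiM)
  have sup_ge: "emeasure (P j) (Ev j) \<le> ?sup" if "j \<le> J" for j
    by (rule SUP_upper2[OF f_class[OF that]], rule SUP_upper2[OF P_law]) (simp add: Ev_eq)
  show ?thesis
  proof (cases "?p \<le> emeasure (P 0) (Ev 0)")
    case True
    thus ?thesis using sup_ge[of 0] by simp
  next
    case False
    \<comment> \<open>The event stays fixed while layers are added to the law.\<close>
    define q where "q j = measure (P j) (Ev 0)" for j
    have q: "emeasure (P j) (Ev 0) = ennreal (q j)" for j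
      unfolding q_def using prob[of j] by (simp add: finite_measure.emeasure_eq_measure prob_space.finite_measure)
    have "q J < 1 / 2"
    proof (rule sqrt_recursion_lt_half)
      show "0 \<le> q j" for j by (simp add: q_def)
      show "(q (Suc j))\<^sup>2 \<le> 2 * q j" for j
      proof -
        have "b ^ 4 = (b\<^sup>2)\<^sup>2" by (simp flip: power_mult)
        also have "\<dots> = 1 / ((real J)\<^sup>2 * (N * N ^ 3) * W\<^sup>2)"
          unfolding b2 by (simp add: power_divide power_mult_distrib power2_eq_square power3_eq_cube)
        finally have "b ^ 4 * real n ^ d * N ^ 3 = real n ^ d / ((real J)\<^sup>2 * N * W\<^sup>2)"
          using N by simp
        also have "\<dots> \<le> 1 / 2"
          using J_large N W J0 by (simp add: N_def divide_le_eq)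
        finally have "(emeasure (P (Suc j)) (Ev 0))\<^sup>2 \<le> 2 * emeasure (P j) (Ev 0)"
          unfolding P_def Ev_def N_def d_def by (intro bump_field_law_step A_sets)
        hence "ennreal ((q (Suc j))\<^sup>2) \<le> ennreal (2 * q j)"
          unfolding q by (simp add: ennreal_power ennreal_mult q_def)
        thus ?thesis by (simp add: q_def)
      qed
      show "q 0 < 2 * (1 / 4) ^ 2 ^ J"
        using False by (simp add: q q_def ennreal_less_iff not_le)
    qed
    have "ennreal (1 / 2) \<le> ennreal (measure (P J) (space (P J) - Ev 0))"
      using \<open>q J < 1 / 2\<close> Ev_sets[of 0] prob[of J]
      by (intro ennreal_leI) (simp add: prob_space.prob_compl setsP q_def)
    also have "\<dots> = emeasure (P J) (space (P J) - Ev 0)"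
      using prob[of J] by (simp add: finite_measure.emeasure_eq_measure prob_space.finite_measure)
    also have "\<dots> \<le> emeasure (P J) (Ev J)"
    proof (rule emeasure_mono)
      show "space (P J) - Ev 0 \<subseteq> Ev J"
      proof
        fix \<omega> assume \<omega>: "\<omega> \<in> space (P J) - Ev 0"
        have sp: "restrict \<omega> ?C \<in> space (\<Pi>\<^sub>M t\<in>?C. borel)" by (simp add: space_PiM)
        have \<omega>': "\<omega> \<in> space path_space" using \<omega> sets_eq_imp_space_eq[OF setsP[of J]] by auto
        have "hs_dist E (fn \<theta>\<^sub>0 (restrict \<omega> ?C)) (f 0 \<theta>\<^sub>0) < \<psi>"
          using \<omega> \<omega>' sp by (auto simp: Ev_def A_def)
        moreover have "hs_dist E (f J \<theta>\<^sub>0) (f 0 \<theta>\<^sub>0) \<le>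
            hs_dist E (f J \<theta>\<^sub>0) (fn \<theta>\<^sub>0 (restrict \<omega> ?C)) + hs_dist E (fn \<theta>\<^sub>0 (restrict \<omega> ?C)) (f 0 \<theta>\<^sub>0)"
          by (intro H.triangle f_hs fn_hs sp)
        ultimately have "hs_dist E (fn \<theta>\<^sub>0 (restrict \<omega> ?C)) (f J \<theta>\<^sub>0) \<ge> \<psi>"
          using gap H.commute[of "f J \<theta>\<^sub>0"] by simp
        thus "\<omega> \<in> Ev J" using \<omega>' sp by (auto simp: Ev_def A_def)
      qed
    qed (simp add: setsP Ev_sets)
    also have "\<dots> \<le> ?sup" by (rule sup_ge) simp
    finally have "ennreal (1 / 2) \<le> ?sup" .
    moreover have "?p \<le> ennreal (1 / 2)"
    proof (rule ennreal_leI)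
      have "(1 / 4 :: real) ^ 2 ^ J \<le> (1 / 4) ^ 1" by (rule power_decreasing) auto
      thus "2 * (1 / 4 :: real) ^ 2 ^ J \<le> 1 / 2" by simp
    qed
    ultimately show ?thesis by (rule order.trans[rotated])
  qed
qed

theorem theorem6p1:
  fixes E :: "'h::{complex_hilbert, second_countable_topology} set"
    and \<beta> L :: real
    and \<theta>\<^sub>0 :: "real ^ 'd"
  assumes "(UNIV :: 'h set) \<noteq> {0}"
    and "complete_orthonormal_system E"
    and "\<beta> > 0" and "L > 0"
    and "\<forall>i. - pi < \<theta>\<^sub>0 $ i \<and> \<theta>\<^sub>0 $ i < pi"
  shows "liminf (\<lambda>n.
           INF fn\<in>estimators E n.
             SUP f\<in>density_class E \<beta> L.
               SUP P\<in>gaussian_laws E f.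
                 emeasure P {\<omega> \<in> space P.
                   hs_norm E (\<lambda>x. fn \<theta>\<^sub>0 (restrict \<omega> (obs_cube n)) x - f \<theta>\<^sub>0 x)
                     \<ge> real n powr (- (real CARD('d) * \<beta> / (2 * \<beta> + real CARD('d))))})
         > (0 :: ennreal)"
proof -
  obtain e where e: "e \<in> E"
    using complete_orthonormal_system_nonempty assms(1,2) by blast
  \<comment> \<open>With \<open>\<tau>\<^sup>2 = L / 2\<close> the class constraint
    \<open>2 * \<tau>\<^sup>2 \<le> L\<close> is an equality, and twice the rate is at most the
    separation of the densities precisely when
    \<open>W \<le> \<kappa> * n powr \<gamma>\<close>.\<close>
  define \<kappa> where "\<kappa> = L / 8 / (2 * pi) ^ CARD('d)"
  have \<kappa>: "\<kappa> > 0" using assms(4) by (simp add: \<kappa>_def)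
  define \<gamma> where "\<gamma> = real CARD('d) * \<beta> / (2 * \<beta> + real CARD('d))"
  obtain J m where J: "J \<ge> 1" and ev: "\<forall>\<^sub>F n in sequentially. m n \<ge> 1 \<and>
     1 + (real CARD('d) * real (m n)) powr \<beta> \<le> \<kappa> * real n powr \<gamma> \<and>
     2 * real n ^ CARD('d) \<le> (real J)\<^sup>2 * real (m n) ^ CARD('d) * (1 + (real CARD('d) * real (m n)) powr \<beta>)\<^sup>2"
    using bump_parameters_exist[OF assms(3) \<kappa>, of "CARD('d)"] by (auto simp: \<gamma>_def)
  have \<theta>\<^sub>0: "\<theta>\<^sub>0 \<in> freq_cube"
    using assms(5) by (auto simp: freq_cube_def intro: less_imp_le)
  \<comment> \<open>Since \<open>J\<close> does not depend on \<open>n\<close>, this is a uniform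
    lower bound for all large \<open>n\<close> and all estimators.\<close>
  have "0 < ennreal (2 * (1 / 4) ^ 2 ^ J)" by simp
  also have "\<dots> \<le> liminf (\<lambda>n. INF fn\<in>estimators E n. SUP f\<in>density_class E \<beta> L. SUP P\<in>gaussian_laws E f.
      emeasure P {\<omega> \<in> space P. hs_norm E (\<lambda>x. fn \<theta>\<^sub>0 (restrict \<omega> (obs_cube n)) x - f \<theta>\<^sub>0 x) \<ge> real n powr (- \<gamma>)})"
  proof (rule Liminf_bounded)
    show "\<forall>\<^sub>F n in sequentially. ennreal (2 * (1 / 4) ^ 2 ^ J) \<le>
      (INF fn\<in>estimators E n. SUP f\<in>density_class E \<beta> L. SUP P\<in>gaussian_laws E f.
      emeasure P {\<omega> \<in> space P. hs_norm E (\<lambda>x. fn \<theta>\<^sub>0 (restrict \<omega> (obs_cube n)) x - f \<theta>\<^sub>0 x) \<ge> real n powr (- \<gamma>)})"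
      using ev eventually_gt_at_top[of 0]
    proof eventually_elim
      case (elim n)
      let ?W = "1 + (real CARD('d) * real (m n)) powr \<beta>"
      have "2 * real n powr (- \<gamma>) \<le> (sqrt (L / 2))\<^sup>2 / (2 * ?W * (2 * pi) ^ CARD('d))"
      proof -
        have r: "real n powr \<gamma> > 0" using elim by simp
        have W: "?W > 0" by (simp add: add_pos_nonneg)
        have "?W \<le> L / 8 / (2 * pi) ^ CARD('d) * real n powr \<gamma>"
          using elim by (simp add: \<kappa>_def)
        hence le: "8 * ?W * (2 * pi) ^ CARD('d) \<le> L * real n powr \<gamma>"
          by (simp add: field_simps)
        have arith: "2 / x \<le> L / 2 / (2 * w * y)" if "8 * w * y \<le> L * x" "w > 0" "x > 0" "y > 0" for w x y
          using that by (simp add: field_simps)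
        have "2 / real n powr \<gamma> \<le> L / 2 / (2 * ?W * (2 * pi) ^ CARD('d))"
          by (rule arith[OF le W r]) simp
        thus ?thesis using assms(4) by (simp add: powr_minus_divide)
      qed
      thus ?case
        using elim J assms(4)
        by (intro INF_greatest estimation_error_two_points[OF assms(2) e \<theta>\<^sub>0 _ assms(3), where \<tau> = "sqrt (L / 2)" and m = "m n"]) auto
    qed
  qed
  finally show ?thesis by (simp only: \<gamma>_def)
qed

end
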